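(* Suppose $F : I \to \mathbb{R}$, where $I = [0,\rho]$ and $0 < \rho < \infty$. The following are equivalent. (1) $F[-]$ preserves positivity on all positive Hankel matrices with entries in $I$. (2) $F$ is absolutely monotonic on $[0,\rho)$ and $F(\rho) \geq \lim_{x \to \rho^-} F(x)$. (3) $F[-]$ preserves positivity on all positive matrices with entries in $I$. If, instead, $I = [0,\rho)$ where $0 < \rho \leq \infty$, then the same equivalences hold, with (2) replaced by the requirement that $F$ is absolutely monotonic on $[0,\rho)$.
   Context: "Positive" for a matrix means (Hermitian, here real symmetric) positive semidefinite; matrices of all dimensions are considered. For a matrix $A = (a_{ij})$ with entries in $I$, $F[A] := (F(a_{ij}))$, and "$F[-]$ preserves positivity" on a set of positive matrices means that $F[A]$ is positive for every $A$ in the set. A function is absolutely monotonic on $[0,\rho)$ if it is continuous on $[0,\rho)$ and smooth on $(0,\rho)$ with all derivatives of order $k \geq 0$ non-negative on $(0,\rho)$. *)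

theory Defs
  imports
    "HOL-Library.Extended_Real"
    "HOL-Analysis.Derivative"
    "Jordan_Normal_Form.Matrix"
begin

definition positive_mat :: "real mat \<Rightarrow> bool" where
  "positive_mat A \<longleftrightarrow> square_mat A \<and> transpose_mat A = A \<and>
     (\<forall>v \<in> carrier_vec (dim_row A). 0 \<le> scalar_prod v (A *\<^sub>v v))"

definition hankel_mat :: "real mat \<Rightarrow> bool" where
  "hankel_mat A \<longleftrightarrow> square_mat A \<and>
     (\<exists>s :: nat \<Rightarrow> real. \<forall>i < dim_row A. \<forall>j < dim_col A. A $$ (i, j) = s (i + j))"

definition positive_matrices :: "real set \<Rightarrow> real mat set" where
  "positive_matrices I = {A. positive_mat A \<and> elements_mat A \<subseteq> I}"

definition positive_hankel_matrices :: "real set \<Rightarrow> real mat set" where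
  "positive_hankel_matrices I = {A \<in> positive_matrices I. hankel_mat A}"

definition preserves_positivity :: "(real \<Rightarrow> real) \<Rightarrow> real mat set \<Rightarrow> bool" where
  "preserves_positivity F S \<longleftrightarrow> (\<forall>A \<in> S. positive_mat (map_mat F A))"

definition right_open_interval :: "ereal \<Rightarrow> real set" where
  "right_open_interval \<rho> = {x. 0 \<le> x \<and> ereal x < \<rho>}"

text \<open>A function on an interval \<open>I\<close> is represented by a total function, of which only the
  values on \<open>I\<close> matter. In particular the derivatives below are taken only at points of the
  open interval, where they do not depend on the values outside it.\<close>

definition absolutely_monotonic :: "ereal \<Rightarrow> (real \<Rightarrow> real) \<Rightarrow> bool" where
  "absolutely_monotonic \<rho> F \<longleftrightarrow>
     continuous_on (right_open_interval \<rho>) F \<and>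
     (\<forall>k x. 0 < x \<and> ereal x < \<rho> \<longrightarrow>
        (deriv ^^ k) F differentiable (at x) \<and> 0 \<le> (deriv ^^ k) F x)"

end

theory Submission
  imports
    Defs
    "HOL-Analysis.Weierstrass_Theorems"
    "HOL-Analysis.Interval_Integral"
    "HOL-Computational_Algebra.Polynomial"
begin

text \<open>
  Everything is routed through the iterated forward differences of \<open>F\<close>: the function is absolutely
  monotonic exactly when it is continuous and all of them are non-negative. Functions with this
  property are pointwise limits of polynomials with non-negative coefficients, because the
  coefficients of a Bernstein polynomial are forward differences up to positive factors
  (\<open>nonneg_poly_approx\<close>).

  \<^emph>\<open>From absolute monotonicity to all positive matrices.\<close> Non-negative derivatives give non-negative
  differences, so \<open>F\<close> is a limit of polynomials with non-negative coefficients. Such polynomials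
  preserve positivity by the Schur product theorem (\<open>psd_schur\<close>), and positivity survives pointwise
  limits. A jump of \<open>F\<close> at a closed endpoint \<open>\<rho>\<close> is harmless: the indicator function of \<open>\<rho>\<close> is on
  \<open>[0, \<rho>]\<close> the limit of the powers \<open>(x / \<rho>)\<^sup>n\<close>.

  \<^emph>\<open>From Hankel matrices to absolute monotonicity.\<close> Matrices of size two show that \<open>F\<close> is non-negative,
  nondecreasing and midpoint convex along geometric progressions, hence continuous away from \<open>0\<close>;
  a family of matrices of size three with a zero entry gives continuity at \<open>0\<close>. If \<open>F\<close> were smooth, the
  Hankel matrices with entries \<open>a + t / 2\<^bsup>i+j\<^esup>\<close> for small \<open>t\<close>, tested against a vector that
  annihilates the Taylor terms of order below \<open>m\<close>, would give \<open>F\<^bsup>(m)\<^esup>(a) \<ge> 0\<close>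
  (\<open>derivative_nonneg_if_hankel_form\<close>). For continuous \<open>F\<close> this is applied after integrating
  \<open>m\<close> times over windows of length \<open>h\<close>: these integrals inherit the positivity of the forms, and the
  \<open>m\<close>-th derivative of the \<open>m\<close>-fold integral is precisely the \<open>m\<close>-th forward difference of \<open>F\<close> with
  step \<open>h\<close>. So all forward differences are non-negative, and again \<open>F\<close> is a limit of
  polynomials with non-negative coefficients. Their coefficients converge one after the other, which
  makes \<open>F\<close> a power series with non-negative coefficients.
\<close>

section \<open>Positive semidefinite matrices\<close>

text \<open>Entries are given by a function of the indices, and only those below \<open>n\<close> count; so passing
  to a leading block, as the induction on the size needs it, changes \<open>n\<close> and nothing else.\<close>
definition psd :: "nat \<Rightarrow> (nat \<Rightarrow> nat \<Rightarrow> real) \<Rightarrow> bool" where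
  "psd n A \<longleftrightarrow> (\<forall>i<n. \<forall>j<n. A i j = A j i) \<and>
     (\<forall>v. 0 \<le> (\<Sum>i<n. \<Sum>j<n. v i * v j * A i j))"

lemma psd_cong:
  assumes "\<And>i j. i < n \<Longrightarrow> j < n \<Longrightarrow> A i j = B i j"
  shows "psd n A \<longleftrightarrow> psd n B"
proof -
  have "(\<Sum>i<n. \<Sum>j<n. v i * v j * A i j) = (\<Sum>i<n. \<Sum>j<n. v i * v j * B i j)" for v
    using assms by (intro sum.cong refl) simp
  then show ?thesis unfolding psd_def using assms by simp
qed

lemma psd_sym: "psd n A \<Longrightarrow> i < n \<Longrightarrow> j < n \<Longrightarrow> A i j = A j i"
  unfolding psd_def by blast

lemma psd_form_nonneg: "psd n A \<Longrightarrow> 0 \<le> (\<Sum>i<n. \<Sum>j<n. v i * v j * A i j)"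
  unfolding psd_def by blast

lemma positive_mat_iff_psd:
  "positive_mat A \<longleftrightarrow> square_mat A \<and> psd (dim_row A) (\<lambda>i j. A $$ (i, j))"
proof (cases "square_mat A")
  case True
  let ?n = "dim_row A"
  have dim: "dim_col A = ?n" using True by simp
  have sym: "transpose_mat A = A \<longleftrightarrow> (\<forall>i<?n. \<forall>j<?n. A $$ (i, j) = A $$ (j, i))"
    using dim by (auto simp: mat_eq_iff)
  have form: "scalar_prod v (A *\<^sub>v v) = (\<Sum>i<?n. \<Sum>j<?n. vec_index v i * vec_index v j * A $$ (i, j))"
    if "v \<in> carrier_vec ?n" for v
    using that dim
    by (auto simp: scalar_prod_def sum_distrib_left lessThan_atLeast0 ac_simps intro!: sum.cong)
  have "(\<forall>v \<in> carrier_vec ?n. 0 \<le> scalar_prod v (A *\<^sub>v v)) \<longleftrightarrow>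
      (\<forall>v. 0 \<le> (\<Sum>i<?n. \<Sum>j<?n. v i * v j * A $$ (i, j)))" (is "?L \<longleftrightarrow> ?R")
  proof
    assume L: ?L
    show ?R
    proof
      fix v :: "nat \<Rightarrow> real"
      have "0 \<le> scalar_prod (vec ?n v) (A *\<^sub>v vec ?n v)" using L by simp
      then show "0 \<le> (\<Sum>i<?n. \<Sum>j<?n. v i * v j * A $$ (i, j))"
        using form[of "vec ?n v"] by simp
    qed
  next
    assume ?R then show ?L using form by simp
  qed
  then show ?thesis unfolding positive_mat_def psd_def using True sym by simp
next
  case False
  then show ?thesis by (simp add: positive_mat_def)
qed

lemma rank_one_form:
  fixes v u :: "nat \<Rightarrow> real"
  shows "(\<Sum>i<n. \<Sum>j<n. v i * v j * (u i * u j)) = (\<Sum>i<n. v i * u i)\<^sup>2"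
  by (simp add: power2_eq_square sum_product ac_simps)

lemma psd_diag_nonneg:
  assumes "psd n A" "k < n"
  shows "0 \<le> A k k"
proof -
  define v :: "nat \<Rightarrow> real" where "v = (\<lambda>i. if i = k then 1 else 0)"
  have v: "(\<Sum>i<n. v i * f i) = f k" for f :: "nat \<Rightarrow> real"
  proof -
    have "(\<Sum>i<n. v i * f i) = (\<Sum>i<n. if i = k then f i else 0)"
      by (intro sum.cong) (auto simp: v_def)
    then show ?thesis using assms(2) by simp
  qed
  have "0 \<le> (\<Sum>i<n. \<Sum>j<n. v i * v j * A i j)"
    by (rule psd_form_nonneg[OF assms(1)])
  also have "\<dots> = (\<Sum>i<n. v i * (\<Sum>j<n. v j * A i j))"
    by (simp only: sum_distrib_left mult.assoc)
  also have "\<dots> = A k k" unfolding v ..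
  finally show ?thesis .
qed

text \<open>The vector \<open>e\<^sub>i + s e\<^sub>n\<close> turns the form into a function that is affine in \<open>s\<close>, and an affine function
  that is bounded below has slope zero.\<close>
lemma psd_zero_diag:
  assumes A: "psd (Suc n) A" and 0: "A n n = 0" and i: "i < n"
  shows "A i n = 0"
proof -
  have q: "0 \<le> A i i + 2 * s * A i n" for s
  proof -
    define v where "v = (\<lambda>k. if k = n then s else if k = i then 1 else 0)"
    have v: "(\<Sum>k<Suc n. v k * f k) = f i + s * f n" for f :: "nat \<Rightarrow> real"
    proof -
      have "(\<Sum>k<n. v k * f k) = (\<Sum>k<n. if k = i then f k else 0)"
        by (intro sum.cong) (auto simp: v_def)
      then show ?thesis using i by (simp add: v_def)
    qed
    have "0 \<le> (\<Sum>k<Suc n. \<Sum>l<Suc n. v k * v l * A k l)"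
      by (rule psd_form_nonneg[OF A])
    also have "\<dots> = (\<Sum>k<Suc n. v k * (\<Sum>l<Suc n. v l * A k l))"
      by (simp only: sum_distrib_left mult.assoc)
    also have "\<dots> = A i i + s * A i n + s * A n i"
      unfolding v using 0 by simp
    also have "A n i = A i n" using psd_sym[OF A, of n i] i by simp
    finally show ?thesis by (simp add: algebra_simps)
  qed
  show ?thesis
  proof (rule ccontr)
    assume "A i n \<noteq> 0"
    then show False using q[of "- (A i i + 1) / (2 * A i n)"] by (simp add: field_simps)
  qed
qed

text \<open>One step of Cholesky elimination: subtracting the rank-one matrix built from the last column
  leaves a positive matrix of smaller size.\<close>
lemma psd_gram:
  assumes "psd n A"
  shows "\<exists>u :: nat \<Rightarrow> nat \<Rightarrow> real. \<forall>i<n. \<forall>j<n. A i j = (\<Sum>k<n. u k i * u k j)"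
  using assms
proof (induction n arbitrary: A)
  case 0
  then show ?case by simp
next
  case (Suc n)
  define d where "d = A n n"
  have d: "0 \<le> d" unfolding d_def using psd_diag_nonneg[OF Suc.prems] by simp
  have sym: "A i j = A j i" if "i \<le> n" "j \<le> n" for i j
    using psd_sym[OF Suc.prems] that by (simp add: less_Suc_eq_le)
  have z: "A i n = 0" if "d = 0" "i \<le> n" for i
    using that psd_zero_diag[OF Suc.prems] d_def by (cases "i = n") auto
  \<comment> \<open>The Schur complement. If \<open>d = 0\<close>, division by zero makes \<open>B = A\<close>, which is right since then
    the last row and column of \<open>A\<close> vanish.\<close>
  define B where "B = (\<lambda>i j. A i j - A i n * A j n / d)"
  have "psd n B"
    unfolding psd_def
  proof (intro conjI allI impI)
    fix i j assume "i < n" "j < n"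
    then show "B i j = B j i" unfolding B_def using sym by simp
  next
    fix v :: "nat \<Rightarrow> real"
    define l where "l = (\<Sum>i<n. v i * A i n)"
    \<comment> \<open>Choosing the last coordinate to minimise the form of \<open>A\<close> leaves the form of \<open>B\<close>.\<close>
    define w where "w = (\<lambda>i. if i = n then - l / d else v i)"
    have vw: "(\<Sum>i<n. \<Sum>j<n. w i * w j * A i j) = (\<Sum>i<n. \<Sum>j<n. v i * v j * A i j)"
      by (intro sum.cong refl) (simp add: w_def)
    have col: "(\<Sum>i<n. w i * w n * A i n) = w n * l"
      unfolding l_def sum_distrib_left by (intro sum.cong refl) (simp add: w_def)
    have row: "(\<Sum>j<n. w n * w j * A n j) = w n * l"
      unfolding col[symmetric]
    proof (intro sum.cong refl)
      fix j assume "j \<in> {..<n}"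
      then have "A n j = A j n" by (intro sym) auto
      then show "w n * w j * A n j = w j * w n * A j n" by simp
    qed
    have "0 \<le> (\<Sum>i<Suc n. \<Sum>j<Suc n. w i * w j * A i j)"
      by (rule psd_form_nonneg[OF Suc.prems])
    also have "\<dots> = (\<Sum>i<n. \<Sum>j<n. w i * w j * A i j) + (\<Sum>i<n. w i * w n * A i n)
        + (\<Sum>j<n. w n * w j * A n j) + w n * w n * A n n"
      by (simp only: sum.lessThan_Suc sum.distrib add.assoc)
    also have "\<dots> = (\<Sum>i<n. \<Sum>j<n. v i * v j * A i j) + w n * l + w n * l + w n * w n * d"
      unfolding vw row unfolding col d_def ..
    also have "\<dots> = (\<Sum>i<n. \<Sum>j<n. v i * v j * A i j) - l\<^sup>2 / d"
      by (cases "d = 0") (simp_all add: w_def power2_eq_square field_simps)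
    also have "l\<^sup>2 / d = (\<Sum>i<n. \<Sum>j<n. v i * v j * (A i n * A j n / d))"
      unfolding l_def rank_one_form[symmetric] by (simp add: sum_divide_distrib)
    also have "(\<Sum>i<n. \<Sum>j<n. v i * v j * A i j) - \<dots> = (\<Sum>i<n. \<Sum>j<n. v i * v j * B i j)"
      unfolding B_def right_diff_distrib sum_subtractf ..
    finally show "0 \<le> (\<Sum>i<n. \<Sum>j<n. v i * v j * B i j)" .
  qed
  from Suc.IH[OF this] obtain u :: "nat \<Rightarrow> nat \<Rightarrow> real"
    where u: "\<And>i j. i < n \<Longrightarrow> j < n \<Longrightarrow> B i j = (\<Sum>k<n. u k i * u k j)" by blast
  define u' where "u' = (\<lambda>k i. if k = n then A i n / sqrt d else if i = n then 0 else u k i)"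
  have "A i j = (\<Sum>k<Suc n. u' k i * u' k j)" if "i < Suc n" "j < Suc n" for i j
  proof -
    have "A i j = (if i = n \<or> j = n then 0 else B i j) + A i n * A j n / d"
    proof (cases "d = 0")
      case True
      then have "i = n \<or> j = n \<Longrightarrow> A i j = 0"
        using z[of i] z[of j] sym[of i j] that by auto
      with True show ?thesis by (simp add: B_def)
    next
      case False
      then show ?thesis using sym[of n j] that by (auto simp: B_def d_def)
    qed
    also have "(if i = n \<or> j = n then 0 else B i j) = (\<Sum>k<n. u' k i * u' k j)"
      using that u[of i j] by (simp add: u'_def)
    also have "A i n * A j n / d = u' n i * u' n j"
      using d by (simp add: u'_def)
    finally show ?thesis by simp
  qed
  then show ?case by blast
qed

text \<open>The Schur product theorem. A Gram decomposition of \<open>A\<close> writes the form of the entrywise product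
  as a sum of forms of \<open>B\<close> at rescaled vectors.\<close>
lemma psd_schur:
  assumes A: "psd n A" and B: "psd n B"
  shows "psd n (\<lambda>i j. A i j * B i j)"
  unfolding psd_def
proof (intro conjI allI impI)
  fix i j assume "i < n" "j < n"
  then show "A i j * B i j = A j i * B j i"
    by (intro arg_cong2[where f = "(*)"] psd_sym[OF A] psd_sym[OF B])
next
  fix v :: "nat \<Rightarrow> real"
  obtain u :: "nat \<Rightarrow> nat \<Rightarrow> real"
    where u: "\<And>i j. i < n \<Longrightarrow> j < n \<Longrightarrow> A i j = (\<Sum>k<n. u k i * u k j)"
    using psd_gram[OF A] by blast
  have "(\<Sum>i<n. \<Sum>j<n. v i * v j * (A i j * B i j))
      = (\<Sum>i<n. \<Sum>j<n. \<Sum>k<n. (v i * u k i) * (v j * u k j) * B i j)"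
  proof (intro sum.cong refl)
    fix i j assume "i \<in> {..<n}" "j \<in> {..<n}"
    then have "v i * v j * (A i j * B i j) = (\<Sum>k<n. u k i * u k j) * (v i * v j * B i j)"
      using u[of i j] by simp
    also have "\<dots> = (\<Sum>k<n. (v i * u k i) * (v j * u k j) * B i j)"
      unfolding sum_distrib_right by (intro sum.cong refl) simp
    finally show "v i * v j * (A i j * B i j) = (\<Sum>k<n. (v i * u k i) * (v j * u k j) * B i j)" .
  qed
  also have "\<dots> = (\<Sum>i<n. \<Sum>k<n. \<Sum>j<n. (v i * u k i) * (v j * u k j) * B i j)"
    by (intro sum.cong refl sum.swap)
  also have "\<dots> = (\<Sum>k<n. \<Sum>i<n. \<Sum>j<n. (v i * u k i) * (v j * u k j) * B i j)"
    by (rule sum.swap)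
  also have "\<dots> \<ge> 0"
    by (intro sum_nonneg psd_form_nonneg[OF B])
  finally show "0 \<le> (\<Sum>i<n. \<Sum>j<n. v i * v j * (A i j * B i j))" .
qed

lemma psd_poly:
  assumes A: "psd n A" and p: "\<And>k. 0 \<le> coeff p k"
  shows "psd n (\<lambda>i j. poly p (A i j))"
  using p
proof (induction p rule: pCons_induct)
  case 0
  then show ?case by (simp add: psd_def)
next
  case (pCons c p)
  have c: "0 \<le> c" using pCons.prems[of 0] by simp
  have "psd n (\<lambda>i j. poly p (A i j))"
    using pCons.IH pCons.prems[of "Suc _"] by simp
  then have Ap: "psd n (\<lambda>i j. A i j * poly p (A i j))" by (rule psd_schur[OF A])
  have "(\<Sum>i<n. \<Sum>j<n. v i * v j * poly (pCons c p) (A i j)) =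
      c * (\<Sum>i<n. v i)\<^sup>2 + (\<Sum>i<n. \<Sum>j<n. v i * v j * (A i j * poly p (A i j)))" for v
  proof -
    have "c * (\<Sum>i<n. v i)\<^sup>2 = (\<Sum>i<n. \<Sum>j<n. v i * v j * c)"
      unfolding power2_eq_square sum_product
      by (simp only: sum_distrib_left mult.commute mult.left_commute)
    then show ?thesis by (simp add: distrib_left sum.distrib)
  qed
  then have "0 \<le> (\<Sum>i<n. \<Sum>j<n. v i * v j * poly (pCons c p) (A i j))" for v
    using c psd_form_nonneg[OF Ap, of v] by simp
  moreover have "poly (pCons c p) (A i j) = poly (pCons c p) (A j i)" if "i < n" "j < n" for i j
    using psd_sym[OF A that] by (rule arg_cong)
  ultimately show ?case unfolding psd_def by blast
qed

lemma psd_limit: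
  assumes "\<And>m. psd n (A m)"
    and "\<And>i j. i < n \<Longrightarrow> j < n \<Longrightarrow> (\<lambda>m. A m i j) \<longlonglongrightarrow> B i j"
  shows "psd n B"
  unfolding psd_def
proof (intro conjI allI impI)
  fix i j assume "i < n" "j < n"
  then have "(\<lambda>m. A m i j) \<longlonglongrightarrow> B i j" "(\<lambda>m. A m j i) \<longlonglongrightarrow> B j i" "\<And>m. A m i j = A m j i"
    using assms(2) psd_sym[OF assms(1)] by blast+
  then show "B i j = B j i" using LIMSEQ_unique by auto
next
  fix v :: "nat \<Rightarrow> real"
  have "(\<lambda>m. \<Sum>i<n. \<Sum>j<n. v i * v j * A m i j) \<longlonglongrightarrow> (\<Sum>i<n. \<Sum>j<n. v i * v j * B i j)"
    using assms(2) by (intro tendsto_intros) auto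
  then show "0 \<le> (\<Sum>i<n. \<Sum>j<n. v i * v j * B i j)"
    by (rule LIMSEQ_le_const) (use psd_form_nonneg[OF assms(1)] in blast)
qed

lemma preserves_positivity_positive_matricesI:
  assumes "\<And>n A. psd n A \<Longrightarrow> (\<And>i j. i < n \<Longrightarrow> j < n \<Longrightarrow> A i j \<in> I) \<Longrightarrow> psd n (\<lambda>i j. F (A i j))"
  shows "preserves_positivity F (positive_matrices I)"
  unfolding preserves_positivity_def
proof
  fix A assume "A \<in> positive_matrices I"
  then have A: "square_mat A" "psd (dim_row A) (\<lambda>i j. A $$ (i, j))" "elements_mat A \<subseteq> I"
    by (auto simp: positive_matrices_def positive_mat_iff_psd)
  have "A $$ (i, j) \<in> I" if "i < dim_row A" "j < dim_row A" for i j
  proof -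
    have "A $$ (i, j) \<in> elements_mat A"
      using that A(1) by (intro elements_matI[of A "dim_row A" "dim_col A"]) auto
    then show ?thesis using A(3) by blast
  qed
  from assms[OF A(2) this] have "psd (dim_row A) (\<lambda>i j. map_mat F A $$ (i, j))"
    using A(1) by (subst psd_cong[where B = "\<lambda>i j. F (A $$ (i, j))"]) auto
  then show "positive_mat (map_mat F A)"
    using A(1) by (simp add: positive_mat_iff_psd)
qed

text \<open>A Hankel matrix is determined by its sequence \<open>s\<close> of antidiagonal entries; the hypothesis on
  Hankel matrices enters the later arguments in this form.\<close>
lemma preserves_positivity_hankelD:
  assumes F: "preserves_positivity F (positive_hankel_matrices I)"
    and s: "psd n (\<lambda>i j. s (i + j))" and I: "\<And>i j. i < n \<Longrightarrow> j < n \<Longrightarrow> s (i + j) \<in> I"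
  shows "psd n (\<lambda>i j. F (s (i + j)))"
proof -
  define A where "A = mat n n (\<lambda>(i, j). s (i + j))"
  have "psd n (\<lambda>i j. A $$ (i, j))"
    using s by (subst psd_cong[where B = "\<lambda>i j. s (i + j)"]) (auto simp: A_def)
  then have "positive_mat A"
    by (simp add: positive_mat_iff_psd A_def)
  moreover have "elements_mat A \<subseteq> I" using I by (auto simp: A_def dest!: elements_matD)
  moreover have "hankel_mat A" unfolding hankel_mat_def A_def by auto
  ultimately have "positive_mat (map_mat F A)"
    using F by (simp add: preserves_positivity_def positive_hankel_matrices_def positive_matrices_def)
  then have "psd n (\<lambda>i j. map_mat F A $$ (i, j))"
    by (simp add: positive_mat_iff_psd A_def)
  then show ?thesis
    by (subst (asm) psd_cong[where B = "\<lambda>i j. F (s (i + j))"]) (auto simp: A_def)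
qed

section \<open>Forward differences and Bernstein polynomials\<close>

definition fdiff :: "real \<Rightarrow> (real \<Rightarrow> real) \<Rightarrow> real \<Rightarrow> real" where
  "fdiff h f x = f (x + h) - f x"

lemma fdiff_Suc: "(fdiff h ^^ Suc m) f x = (fdiff h ^^ m) f (x + h) - (fdiff h ^^ m) f x"
  by (simp add: fdiff_def)

lemma fdiff_Suc': "(fdiff h ^^ Suc m) f = (fdiff h ^^ m) (fdiff h f)"
  by (simp only: funpow_Suc_right o_apply)

lemma fdiff_scale: "(fdiff h ^^ m) (\<lambda>x. f (b * x)) x = (fdiff (b * h) ^^ m) f (b * x)"
proof (induction m arbitrary: x)
  case (Suc m)
  then show ?case by (simp only: fdiff_Suc distrib_left)
qed simp

lemma fdiff_cong:
  assumes "\<And>y. x \<le> y \<Longrightarrow> y \<le> x + real m * h \<Longrightarrow> f y = g y" "0 \<le> h"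
  shows "(fdiff h ^^ m) f x = (fdiff h ^^ m) g x"
  using assms(1)
proof (induction m arbitrary: x)
  case (Suc m)
  have "(fdiff h ^^ m) f (x + h) = (fdiff h ^^ m) g (x + h)"
    using assms(2) by (intro Suc.IH Suc.prems) (auto simp: algebra_simps)
  moreover have "(fdiff h ^^ m) f x = (fdiff h ^^ m) g x"
    using assms(2) by (intro Suc.IH Suc.prems) (auto simp: algebra_simps)
  ultimately show ?case by (simp only: fdiff_Suc)
qed simp

text \<open>A Bernstein polynomial of \<open>f\<close> has step \<open>h = 1 / n\<close>. The step is kept separate from the degree
  so that a recursion in \<open>n\<close> is possible.\<close>
definition bernstein_sum :: "nat \<Rightarrow> real \<Rightarrow> (real \<Rightarrow> real) \<Rightarrow> real \<Rightarrow> real" where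
  "bernstein_sum n h f x = (\<Sum>k\<le>n. f (real k * h) * Bernstein n k x)"

lemma Bernstein_Suc:
  "Bernstein (Suc n) (Suc k) x = x * Bernstein n k x + (1 - x) * Bernstein n (Suc k) x"
proof (cases "k < n")
  case True
  then have "n - k = Suc (n - Suc k)" by simp
  then show ?thesis by (simp add: Bernstein_def algebra_simps)
next
  case False
  then show ?thesis by (simp add: Bernstein_def binomial_eq_0)
qed

text \<open>Pascal's rule for the basis polynomials, summed by parts: the shifted sum minus the original
  one is the sum for the difference of \<open>f\<close>.\<close>
lemma bernstein_sum_Suc:
  "bernstein_sum (Suc n) h f x = bernstein_sum n h f x + x * bernstein_sum n h (fdiff h f) x"
proof -
  have 0: "Bernstein (Suc n) 0 x = (1 - x) * Bernstein n 0 x" by (simp add: Bernstein_def)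
  have n: "Bernstein n (Suc n) x = 0" by (simp add: Bernstein_def)
  have "bernstein_sum (Suc n) h f x = f 0 * Bernstein (Suc n) 0 x +
      (\<Sum>k\<le>n. f (real (Suc k) * h) * Bernstein (Suc n) (Suc k) x)"
    unfolding bernstein_sum_def by (subst sum.atMost_Suc_shift) simp
  also have "\<dots> = x * (\<Sum>k\<le>n. f (real (Suc k) * h) * Bernstein n k x) + (1 - x) *
      (f 0 * Bernstein n 0 x + (\<Sum>k\<le>n. f (real (Suc k) * h) * Bernstein n (Suc k) x))"
    unfolding 0 Bernstein_Suc
    by (simp add: distrib_left sum.distrib sum_distrib_left mult.left_commute)
  also have "f 0 * Bernstein n 0 x + (\<Sum>k\<le>n. f (real (Suc k) * h) * Bernstein n (Suc k) x)
      = (\<Sum>k\<le>Suc n. f (real k * h) * Bernstein n k x)"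
    by (subst sum.atMost_Suc_shift) simp
  also have "\<dots> = bernstein_sum n h f x"
    unfolding bernstein_sum_def by (simp add: n)
  also have "(\<Sum>k\<le>n. f (real (Suc k) * h) * Bernstein n k x)
      = bernstein_sum n h (fdiff h f) x + bernstein_sum n h f x"
    unfolding bernstein_sum_def sum.distrib[symmetric] fdiff_def
    by (intro sum.cong refl) (simp add: algebra_simps)
  finally show ?thesis by (simp add: algebra_simps)
qed

text \<open>In the monomial basis the coefficient at \<open>x\<^sup>j\<close> is \<open>n choose j\<close> times the \<open>j\<close>-th difference of \<open>f\<close>
  at \<open>0\<close>. The recursion yields the sign of the coefficients without this formula.\<close>
lemma bernstein_sum_poly:
  assumes "\<And>i j. i + j \<le> n \<Longrightarrow> 0 \<le> (fdiff h ^^ j) f (real i * h)"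
  shows "\<exists>p. (\<forall>k. 0 \<le> coeff p k) \<and> (\<forall>x. poly p x = bernstein_sum n h f x)"
  using assms
proof (induction n arbitrary: f)
  case 0
  have "0 \<le> f 0" using "0.prems"[of 0 0] by simp
  then show ?case
    by (intro exI[of _ "[:f 0:]"]) (auto simp: bernstein_sum_def Bernstein_def coeff_pCons split: nat.splits)
next
  case (Suc n)
  obtain p where p: "\<forall>k. 0 \<le> coeff p k" "\<forall>x. poly p x = bernstein_sum n h f x"
    using Suc.IH[of f] Suc.prems by fastforce
  have "\<exists>q. (\<forall>k. 0 \<le> coeff q k) \<and> (\<forall>x. poly q x = bernstein_sum n h (fdiff h f) x)"
  proof (rule Suc.IH)
    fix i j assume "i + j \<le> n"
    then show "0 \<le> (fdiff h ^^ j) (fdiff h f) (real i * h)"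
      using Suc.prems[of i "Suc j"] by (simp add: fdiff_Suc' del: funpow.simps)
  qed
  then obtain q where q: "\<forall>k. 0 \<le> coeff q k" "\<forall>x. poly q x = bernstein_sum n h (fdiff h f) x"
    by blast
  show ?case
    using p q
    by (intro exI[of _ "p + pCons 0 q"]) (auto simp: bernstein_sum_Suc coeff_pCons split: nat.splits)
qed

definition fdiffs_nonneg :: "real \<Rightarrow> (real \<Rightarrow> real) \<Rightarrow> bool" where
  "fdiffs_nonneg b f \<longleftrightarrow>
     (\<forall>m h x. 0 < h \<longrightarrow> 0 \<le> x \<longrightarrow> x + real m * h \<le> b \<longrightarrow> 0 \<le> (fdiff h ^^ m) f x)"

text \<open>The Bernstein polynomials of \<open>f (b * x)\<close> on \<open>[0, 1]\<close>, in which the step \<open>1 / n\<close> becomes \<open>b / n\<close>.\<close>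
lemma nonneg_poly_approx:
  assumes b: "0 < b" and cont: "continuous_on {0..b} f" and f: "fdiffs_nonneg b f"
  shows "\<exists>p :: nat \<Rightarrow> real poly. (\<forall>n k. 0 \<le> coeff (p n) k) \<and>
    (\<forall>x\<in>{0..b}. (\<lambda>n. poly (p n) (x / b)) \<longlonglongrightarrow> f x)"
proof -
  define g where "g = (\<lambda>x. f (b * x))"
  have g: "continuous_on {0..1} g"
    unfolding g_def using b
    by (intro continuous_on_compose2[OF cont]) (auto intro!: continuous_intros simp: mult_left_le)
  have "\<exists>p. (\<forall>k. 0 \<le> coeff p k) \<and> (\<forall>x. poly p x = bernstein_sum (Suc n) (1 / real (Suc n)) g x)" for n
  proof (rule bernstein_sum_poly)
    fix i j assume "i + j \<le> Suc n"
    then have "b * (real (i + j) / real (Suc n)) \<le> b * 1"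
      using b by (intro mult_left_mono) (auto simp del: of_nat_add of_nat_Suc)
    then have "b * (real i * (1 / real (Suc n))) + real j * (b * (1 / real (Suc n))) \<le> b"
      by (simp add: add_divide_distrib distrib_left mult.commute)
    then show "0 \<le> (fdiff (1 / real (Suc n)) ^^ j) g (real i * (1 / real (Suc n)))"
      unfolding g_def fdiff_scale using f b unfolding fdiffs_nonneg_def by simp
  qed
  then obtain p where p: "\<And>n k. 0 \<le> coeff (p n) k"
      "\<And>n x. poly (p n) x = bernstein_sum (Suc n) (1 / real (Suc n)) g x"
    by metis
  have "(\<lambda>n. poly (p n) (x / b)) \<longlonglongrightarrow> f x" if x: "x \<in> {0..b}" for x
  proof (rule LIMSEQ_I)
    fix e :: real assume "0 < e"
    from Bernstein_Weierstrass[OF g this] obtain N where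
      N: "\<And>n y. N \<le> n \<Longrightarrow> y \<in> {0..1} \<Longrightarrow> \<bar>g y - (\<Sum>k\<le>n. g (k / n) * Bernstein n k y)\<bar> < e" by blast
    have "x / b \<in> {0..1}" "g (x / b) = f x" using x b by (auto simp: g_def)
    then have "norm (poly (p n) (x / b) - f x) < e" if "N \<le> n" for n
      using N[of "Suc n" "x / b"] that by (simp add: p(2) bernstein_sum_def abs_minus_commute)
    then show "\<exists>no. \<forall>n\<ge>no. norm (poly (p n) (x / b) - f x) < e" by blast
  qed
  with p(1) show ?thesis by blast
qed

text \<open>The jump \<open>c\<close> at the right endpoint costs one monomial in each approximating polynomial, since
  \<open>c (x / b)\<^sup>m\<close> converges on \<open>[0, b]\<close> to \<open>c\<close> times the indicator function of \<open>b\<close>.\<close>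
lemma psd_fdiffs_nonneg:
  assumes b: "0 < b" and cont: "continuous_on {0..b} f" and f: "fdiffs_nonneg b f" and c: "0 \<le> c"
    and A: "psd n A" and Ab: "\<And>i j. i < n \<Longrightarrow> j < n \<Longrightarrow> A i j \<in> {0..b}"
  shows "psd n (\<lambda>i j. f (A i j) + (if A i j = b then c else 0))"
proof -
  obtain p where p: "\<And>m k. 0 \<le> coeff (p m) k"
      "\<And>x. x \<in> {0..b} \<Longrightarrow> (\<lambda>m. poly (p m) (x / b)) \<longlonglongrightarrow> f x"
    using nonneg_poly_approx[OF b cont f] by blast
  have Ab': "psd n (\<lambda>i j. A i j / b)"
    using psd_poly[OF A, of "[:0, 1 / b:]"] b by (simp add: coeff_pCons split: nat.splits)
  define q where "q = (\<lambda>m. p m + monom c m)"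
  have "psd n (\<lambda>i j. poly (q m) (A i j / b))" for m
    by (rule psd_poly[OF Ab']) (simp add: q_def p(1) c)
  then show ?thesis
  proof (rule psd_limit)
    fix i j assume ij: "i < n" "j < n"
    have "(\<lambda>m. c * (A i j / b) ^ m) \<longlonglongrightarrow> (if A i j = b then c else 0)"
    proof (cases "A i j = b")
      case False
      then have "(\<lambda>m. (A i j / b) ^ m) \<longlonglongrightarrow> 0"
        using Ab[OF ij] b by (intro LIMSEQ_power_zero) auto
      then show ?thesis using False tendsto_mult_right_zero by auto
    qed (use b in simp)
    then show "(\<lambda>m. poly (q m) (A i j / b)) \<longlonglongrightarrow> f (A i j) + (if A i j = b then c else 0)"
      unfolding q_def poly_add poly_monom by (intro tendsto_add p(2) Ab[OF ij])
  qed
qed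

section \<open>Absolutely monotonic functions preserve positivity\<close>

text \<open>The difference operator maps the class of functions whose derivatives are all non-negative to
  itself, because each derivative is nondecreasing; the interval shrinks by the step.\<close>
lemma fdiff_nonneg_if_derivs_nonneg:
  assumes D: "\<And>k x. 0 < x \<Longrightarrow> x < b \<Longrightarrow> (D k has_real_derivative D (Suc k) x) (at x)"
    and nonneg: "\<And>k x. 0 < x \<Longrightarrow> x < b \<Longrightarrow> 0 \<le> D k x"
    and h: "0 \<le> h" and x: "0 < x" "x + real m * h < b"
  shows "0 \<le> (fdiff h ^^ m) (D 0) x"
  using assms
proof (induction m arbitrary: D b)
  case 0
  then show ?case by simp
next
  case (Suc m)
  note D = Suc.prems(1) and nonneg = Suc.prems(2) and h = Suc.prems(3)
  have mono: "D k y \<le> D k (y + h)" if "0 < y" "y + h < b" for k y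
  proof (rule DERIV_nonneg_imp_nondecreasing[where f = "D k"])
    show "y \<le> y + h" using h by simp
    show "\<exists>d. (D k has_real_derivative d) (at z) \<and> 0 \<le> d" if "y \<le> z" "z \<le> y + h" for z
      using D[of z k] nonneg[of z "Suc k"] that \<open>0 < y\<close> \<open>y + h < b\<close>
      by (intro exI[of _ "D (Suc k) z"]) simp
  qed
  have "0 \<le> (fdiff h ^^ m) ((\<lambda>k. fdiff h (D k)) 0) x"
  proof (rule Suc.IH[where b = "b - h"])
    fix k y assume y: "0 < y" "y < b - h"
    have "((\<lambda>y. D k (y + h)) has_real_derivative D (Suc k) (y + h)) (at y)"
      using D[of "y + h" k] y h by (simp add: DERIV_shift)
    then show "(fdiff h (D k) has_real_derivative fdiff h (D (Suc k)) y) (at y)"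
      unfolding fdiff_def using y h by (intro DERIV_diff D) auto
    show "0 \<le> fdiff h (D k) y" using mono[of y k] y by (simp add: fdiff_def)
  qed (use Suc.prems in \<open>auto simp: algebra_simps\<close>)
  then show ?case by (simp only: fdiff_Suc')
qed

lemma tendsto_fdiff:
  assumes f: "continuous_on S f"
    and H: "H \<longlonglongrightarrow> h" and X: "X \<longlonglongrightarrow> x"
    and "\<And>j. j \<le> m \<Longrightarrow> x + real j * h \<in> S"
    and "\<And>j n. j \<le> m \<Longrightarrow> X n + real j * H n \<in> S"
  shows "(\<lambda>n. (fdiff (H n) ^^ m) f (X n)) \<longlonglongrightarrow> (fdiff h ^^ m) f x"
  using assms(3-)
proof (induction m arbitrary: X x)
  case 0
  then show ?case
    using continuous_on_tendsto_compose[OF f, of X x] by simp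
next
  case (Suc m)
  have "(\<lambda>n. (fdiff (H n) ^^ m) f (X n + H n)) \<longlonglongrightarrow> (fdiff h ^^ m) f (x + h)"
  proof (rule Suc.IH)
    show "(\<lambda>n. X n + H n) \<longlonglongrightarrow> x + h" by (intro tendsto_add Suc.prems H)
    fix j n assume "j \<le> m"
    then show "x + h + real j * h \<in> S" "X n + H n + real j * H n \<in> S"
      using Suc.prems(2)[of "Suc j"] Suc.prems(3)[of "Suc j" n] by (simp_all add: algebra_simps)
  qed
  moreover have "(\<lambda>n. (fdiff (H n) ^^ m) f (X n)) \<longlonglongrightarrow> (fdiff h ^^ m) f x"
    using Suc.prems by (intro Suc.IH) auto
  ultimately show ?case unfolding fdiff_Suc by (rule tendsto_diff)
qed

lemma fdiffs_nonneg_if_interior: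
  assumes b: "0 < b" and f: "continuous_on {0..b} f"
    and pos: "\<And>m h x. 0 \<le> h \<Longrightarrow> 0 < x \<Longrightarrow> x + real m * h < b \<Longrightarrow> 0 \<le> (fdiff h ^^ m) f x"
  shows "fdiffs_nonneg b f"
  unfolding fdiffs_nonneg_def
proof (intro allI impI)
  fix m :: nat and h x :: real
  assume "0 < h" and x: "0 \<le> x" and mh: "x + real m * h \<le> b"
  then have h: "0 \<le> h" by simp
  \<comment> \<open>Contracting \<open>[0, b]\<close> towards its midpoint moves the arithmetic progression into the interior.\<close>
  define r where "r = (\<lambda>n. 1 - inverse (real (Suc n)))"
  define X where "X = (\<lambda>n. r n * x + (1 - r n) * (b / 2))"
  define H where "H = (\<lambda>n. r n * h)"
  have r: "0 \<le> r n" "r n < 1" for n by (auto simp: r_def field_simps)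
  have rlim: "r \<longlonglongrightarrow> 1"
    unfolding r_def using tendsto_diff[OF tendsto_const LIMSEQ_inverse_real_of_nat, of 1] by simp
  have Xlim: "X \<longlonglongrightarrow> x" and Hlim: "H \<longlonglongrightarrow> h"
    unfolding X_def H_def by (auto intro!: tendsto_eq_intros rlim)
  have eq: "X n + real j * H n = r n * (x + real j * h) + (1 - r n) * (b / 2)" for n j
    by (simp add: X_def H_def algebra_simps)
  have jh: "x + real j * h \<le> b" if "j \<le> m" for j
  proof -
    have "real j * h \<le> real m * h" using that h by (intro mult_right_mono) auto
    then show ?thesis using mh by linarith
  qed
  have lt: "X n + real j * H n < b" if "j \<le> m" for n j
  proof -
    have "r n * (x + real j * h) \<le> r n * b" using jh[OF that] r by (intro mult_left_mono) auto
    moreover have "(1 - r n) * (b / 2) < (1 - r n) * b"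
      using r[of n] b by (intro mult_strict_left_mono) auto
    ultimately show ?thesis unfolding eq by (simp add: algebra_simps)
  qed
  have gt: "0 < X n" for n
    unfolding X_def using r[of n] x b by (intro add_nonneg_pos mult_nonneg_nonneg mult_pos_pos) auto
  have H0: "0 \<le> H n" for n using r[of n] h by (simp add: H_def)
  have "(\<lambda>n. (fdiff (H n) ^^ m) f (X n)) \<longlonglongrightarrow> (fdiff h ^^ m) f x"
  proof (rule tendsto_fdiff[OF f Hlim Xlim])
    fix j n assume j: "j \<le> m"
    show "x + real j * h \<in> {0..b}" using jh[OF j] x h by simp
    show "X n + real j * H n \<in> {0..b}"
      using lt[OF j, of n] less_imp_le[OF gt[of n]] H0[of n] by (simp add: order_less_imp_le)
  qed
  moreover have "0 \<le> (fdiff (H n) ^^ m) f (X n)" for n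
    by (rule pos[OF H0 gt lt]) simp
  ultimately show "0 \<le> (fdiff h ^^ m) f x"
    by (intro LIMSEQ_le_const) auto
qed

text \<open>\<open>G\<close> is \<open>F\<close> up to a continuous modification at the endpoint \<open>b\<close>, as a jump of \<open>F\<close> there requires.\<close>
lemma absolutely_monotonic_fdiffs_nonneg:
  assumes am: "absolutely_monotonic \<rho> F" and b: "0 < b" "ereal b \<le> \<rho>"
    and G: "continuous_on {0..b} G" and GF: "\<And>x. 0 \<le> x \<Longrightarrow> x < b \<Longrightarrow> G x = F x"
  shows "fdiffs_nonneg b G"
proof (rule fdiffs_nonneg_if_interior[OF b(1) G])
  fix m :: nat and h x :: real
  assume hx: "0 \<le> h" "0 < x" "x + real m * h < b"
  have in_dom: "ereal y < \<rho>" if "y < b" for y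
    using that b(2) by (metis ereal_less_eq(3) less_le_not_le order_less_le_trans ereal_less(2) less_ereal.simps(1))
  have "0 \<le> (fdiff h ^^ m) ((\<lambda>k. (deriv ^^ k) F) 0) x"
  proof (rule fdiff_nonneg_if_derivs_nonneg[OF _ _ hx])
    fix k y assume y: "0 < y" "y < b"
    then have "(deriv ^^ k) F differentiable (at y)" "0 \<le> (deriv ^^ k) F y"
      using am in_dom unfolding absolutely_monotonic_def by blast+
    then show "0 \<le> (deriv ^^ k) F y"
      and "((deriv ^^ k) F has_real_derivative (deriv ^^ Suc k) F y) (at y)"
      by (auto simp: DERIV_deriv_iff_real_differentiable)
  qed
  also have "(fdiff h ^^ m) ((\<lambda>k. (deriv ^^ k) F) 0) x = (fdiff h ^^ m) G x"
    using hx by (intro fdiff_cong) (auto simp: GF)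
  finally show "0 \<le> (fdiff h ^^ m) G x" .
qed

text \<open>Replacing the value at \<open>\<rho>\<close> by the limit \<open>L\<close> makes \<open>F\<close> continuous on the closed interval; the
  non-negative remainder \<open>F \<rho> - L\<close> is a jump at the endpoint.\<close>
lemma preserves_positivity_closed:
  assumes am: "absolutely_monotonic (ereal \<rho>) F" and \<rho>: "0 < \<rho>"
    and L: "(F \<longlongrightarrow> L) (at_left \<rho>)" and LF: "L \<le> F \<rho>"
  shows "preserves_positivity F (positive_matrices {0..\<rho>})"
proof (rule preserves_positivity_positive_matricesI)
  fix n A assume A: "psd n A" and AI: "\<And>i j. i < n \<Longrightarrow> j < n \<Longrightarrow> A i j \<in> {0..\<rho>}"
  define G where "G = (\<lambda>x. if x = \<rho> then L else F x)"
  have cF: "continuous_on {0..<\<rho>} F"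
    using am by (simp add: absolutely_monotonic_def right_open_interval_def atLeastLessThan_def
        atLeast_def lessThan_def Collect_conj_eq)
  have "continuous_on {0..\<rho>} G"
    unfolding continuous_on_def
  proof
    fix x assume x: "x \<in> {0..\<rho>}"
    show "(G \<longlongrightarrow> G x) (at x within {0..\<rho>})"
    proof (cases "x = \<rho>")
      case True
      have "(G \<longlongrightarrow> L) (at_left \<rho>)"
        by (rule Lim_transform_eventually[OF L]) (auto simp: eventually_at_filter G_def)
      then show ?thesis
        using True \<rho> by (simp add: G_def at_within_Icc_at_left)
    next
      case False
      then have "x \<in> {0..<\<rho>}" using x by auto
      then have "(F \<longlongrightarrow> F x) (at x within {0..<\<rho>})" using cF by (auto simp: continuous_on_def)
      moreover have "at x within {0..\<rho>} = at x within {0..<\<rho>}"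
        using \<open>x \<in> {0..<\<rho>}\<close> by (intro at_within_nhd[of x "{..<\<rho>}"]) auto
      ultimately have "(F \<longlongrightarrow> F x) (at x within {0..\<rho>})" by simp
      then have "(G \<longlongrightarrow> F x) (at x within {0..\<rho>})"
      proof (rule Lim_transform_eventually)
        have "\<forall>\<^sub>F y in nhds x. y < \<rho>" using \<open>x \<in> {0..<\<rho>}\<close>
          by (intro eventually_nhds_in_open[of "{..<\<rho>}", simplified]) auto
        then show "\<forall>\<^sub>F y in at x within {0..\<rho>}. F y = G y"
          unfolding eventually_at_filter by eventually_elim (auto simp: G_def)
      qed
      then show ?thesis using False by (simp add: G_def)
    qed
  qed
  moreover from this have "fdiffs_nonneg \<rho> G"
    by (rule absolutely_monotonic_fdiffs_nonneg[OF am \<rho> order_refl]) (simp add: G_def)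
  ultimately have "psd n (\<lambda>i j. G (A i j) + (if A i j = \<rho> then F \<rho> - L else 0))"
    using LF by (intro psd_fdiffs_nonneg[OF \<rho> _ _ _ A AI]) auto
  moreover have "G x + (if x = \<rho> then F \<rho> - L else 0) = F x" for x by (simp add: G_def)
  ultimately show "psd n (\<lambda>i j. F (A i j))" by simp
qed

text \<open>A matrix has finitely many entries, so they all lie in some \<open>[0, b]\<close> with \<open>b < \<rho>\<close>.\<close>
lemma preserves_positivity_open:
  assumes am: "absolutely_monotonic \<rho> F"
  shows "preserves_positivity F (positive_matrices (right_open_interval \<rho>))"
proof (rule preserves_positivity_positive_matricesI)
  fix n A assume A: "psd n A"
    and AI: "\<And>i j. i < n \<Longrightarrow> j < n \<Longrightarrow> A i j \<in> right_open_interval \<rho>"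
  show "psd n (\<lambda>i j. F (A i j))"
  proof (cases "n = 0")
    case True
    then show ?thesis by (simp add: psd_def)
  next
    case False
    define E where "E = (\<lambda>(i, j). A i j) ` ({..<n} \<times> {..<n})"
    have E: "finite E" "E \<noteq> {}" "E \<subseteq> right_open_interval \<rho>"
      using False AI by (auto simp: E_def)
    then have "Max E \<in> right_open_interval \<rho>" using Max_in[of E] by blast
    then have M: "0 \<le> Max E" "ereal (Max E) < \<rho>" by (auto simp: right_open_interval_def)
    then obtain b where "ereal (Max E) < ereal b" and b\<rho>: "ereal b < \<rho>"
      using ereal_dense2 by blast
    then have Mb: "Max E < b" and b: "0 < b" using M(1) by auto
    have Ab: "A i j \<in> {0..b}" if "i < n" "j < n" for i j
    proof -
      have "A i j \<in> E" using that by (auto simp: E_def)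
      then have "A i j \<le> Max E" "0 \<le> A i j"
        using E by (auto simp: right_open_interval_def)
      with Mb show ?thesis by simp
    qed
    have "ereal x < \<rho>" if "x \<le> b" for x
      using that b\<rho> by (metis ereal_less_eq(3) order_le_less_trans)
    then have "{0..b} \<subseteq> right_open_interval \<rho>" by (auto simp: right_open_interval_def)
    then have cont: "continuous_on {0..b} F"
      using am continuous_on_subset by (auto simp: absolutely_monotonic_def)
    have "fdiffs_nonneg b F"
      using b\<rho> by (intro absolutely_monotonic_fdiffs_nonneg[OF am b _ cont]) simp_all
    from psd_fdiffs_nonneg[OF b cont this order_refl A Ab] show ?thesis by simp
  qed
qed

section \<open>Non-negative forward differences give a power series\<close>

lemma poly_nonneg_coeffs:
  fixes p :: "real poly"
  assumes "\<And>k. 0 \<le> coeff p k" "0 \<le> x" "x \<le> y"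
  shows "0 \<le> poly p x" "poly p x \<le> poly p y"
proof -
  have "0 \<le> poly p x \<and> poly p x \<le> poly p y"
    using assms(1)
  proof (induction p rule: pCons_induct)
    case (pCons c p)
    have "0 \<le> c" "0 \<le> poly p x" "poly p x \<le> poly p y"
      using pCons.prems[of 0] pCons.IH pCons.prems[of "Suc _"] by auto
    then show ?case using assms(2,3) by (auto intro!: mult_mono)
  qed simp
  then show "0 \<le> poly p x" "poly p x \<le> poly p y" by auto
qed

lemma poly_shift_pCons: "poly_shift k p = pCons (coeff p k) (poly_shift (Suc k) p)"
  by (rule poly_eqI) (simp add: coeff_poly_shift coeff_pCons split: nat.split)

lemma poly_split_at:
  fixes p :: "real poly"
  shows "poly p y = (\<Sum>j<k. coeff p j * y ^ j) + y ^ k * poly (poly_shift k p) y"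
proof (induction k)
  case (Suc k)
  then show ?case by (subst (asm) poly_shift_pCons) (simp add: algebra_simps)
qed simp

text \<open>The tail is \<open>y\<^sup>k\<close> times a polynomial with non-negative coefficients, which is nondecreasing.\<close>
lemma poly_tail_bounds:
  fixes p :: "real poly"
  assumes p: "\<And>k. 0 \<le> coeff p k" and y: "0 \<le> y" "y \<le> 1"
  shows "0 \<le> poly p y - (\<Sum>j<k. coeff p j * y ^ j)"
    and "poly p y - (\<Sum>j<k. coeff p j * y ^ j) \<le> y ^ k * poly p 1"
proof -
  have s: "\<And>j. 0 \<le> coeff (poly_shift k p) j" using p by (simp add: coeff_poly_shift)
  have eq: "poly p y - (\<Sum>j<k. coeff p j * y ^ j) = y ^ k * poly (poly_shift k p) y"
    using poly_split_at[of p y k] by simp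
  show "0 \<le> poly p y - (\<Sum>j<k. coeff p j * y ^ j)"
    unfolding eq using poly_nonneg_coeffs(1)[OF s y(1) order_refl] y by simp
  have "poly (poly_shift k p) y \<le> poly (poly_shift k p) 1"
    by (rule poly_nonneg_coeffs(2)[OF s y])
  also have "\<dots> \<le> poly p 1"
    using poly_split_at[of p 1 k] sum_nonneg[of "{..<k}" "coeff p"] p by simp
  finally show "poly p y - (\<Sum>j<k. coeff p j * y ^ j) \<le> y ^ k * poly p 1"
    unfolding eq using y by (intro mult_left_mono) auto
qed

text \<open>Convergence is known only away from \<open>0\<close>, so the constant coefficient is compared with the value at a
  small \<open>y\<close>. By \<open>poly_tail_bounds\<close> they are within \<open>y * M\<close> of each other, uniformly in \<open>n\<close>, and hence the
  constant coefficients form a Cauchy sequence.\<close>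
lemma convergent_constant_coeff:
  fixes q :: "nat \<Rightarrow> real poly"
  assumes q: "\<And>n k. 0 \<le> coeff (q n) k"
    and lim: "\<And>y. 0 < y \<Longrightarrow> y \<le> 1 \<Longrightarrow> convergent (\<lambda>n. poly (q n) y)"
  shows "convergent (\<lambda>n. coeff (q n) 0)"
proof -
  have "Bseq (\<lambda>n. poly (q n) 1)" using lim[of 1] by (intro convergent_imp_Bseq) simp
  then obtain M where M: "0 < M" "\<And>n. norm (poly (q n) 1) \<le> M" by (auto elim: BseqE)
  have near: "\<bar>poly (q n) y - coeff (q n) 0\<bar> \<le> y * M" if "0 < y" "y \<le> 1" for n y
  proof -
    have "y * poly (q n) 1 \<le> y * M" using M(2)[of n] that by (intro mult_left_mono) auto
    moreover have "0 \<le> poly (q n) y - coeff (q n) 0" "poly (q n) y - coeff (q n) 0 \<le> y * poly (q n) 1"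
      using poly_tail_bounds[OF q, of y n 1] that by simp_all
    ultimately show ?thesis by linarith
  qed
  have "Cauchy (\<lambda>n. coeff (q n) 0)"
  proof (rule CauchyI)
    fix e :: real assume e: "0 < e"
    define y where "y = min 1 (e / (4 * M))"
    have y: "0 < y" "y \<le> 1" "y * M \<le> e / 4"
      using e M(1) by (auto simp: y_def min_def field_simps)
    have "Cauchy (\<lambda>n. poly (q n) y)" using lim[OF y(1,2)] by (rule convergent_Cauchy)
    then obtain N where N: "\<And>m n. N \<le> m \<Longrightarrow> N \<le> n \<Longrightarrow> norm (poly (q m) y - poly (q n) y) < e / 2"
      using CauchyD[of _ "e / 2"] e by (metis half_gt_zero)
    have "norm (coeff (q m) 0 - coeff (q n) 0) < e" if "N \<le> m" "N \<le> n" for m n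
      using N[OF that] near[OF y(1,2), of m] near[OF y(1,2), of n] y(3)
      unfolding real_norm_def by linarith
    then show "\<exists>N. \<forall>m\<ge>N. \<forall>n\<ge>N. norm (coeff (q m) 0 - coeff (q n) 0) < e" by blast
  qed
  then show ?thesis by (rule Cauchy_convergent)
qed

text \<open>Coefficients converge successively: once those below \<open>k\<close> converge, removing them and dividing
  by \<open>y\<^sup>k\<close> gives polynomials that still converge on \<open>(0, 1]\<close> and whose constant coefficients are the
  \<open>k\<close>-th ones. The bound \<open>y\<^sup>k\<close> on the tails then passes to the limit.\<close>
lemma limit_of_nonneg_polys_power_series:
  fixes p :: "nat \<Rightarrow> real poly"
  assumes p: "\<And>n k. 0 \<le> coeff (p n) k"
    and lim: "\<And>y. 0 \<le> y \<Longrightarrow> y \<le> 1 \<Longrightarrow> (\<lambda>n. poly (p n) y) \<longlonglongrightarrow> g y"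
  shows "\<exists>c. (\<forall>k. 0 \<le> c k) \<and> (\<forall>y. 0 \<le> y \<longrightarrow> y < 1 \<longrightarrow> (\<lambda>k. c k * y ^ k) sums g y)"
proof -
  have conv: "convergent (\<lambda>n. coeff (p n) k)" for k
  proof (induction k rule: less_induct)
    case (less k)
    have "convergent (\<lambda>n. coeff (poly_shift k (p n)) 0)"
    proof (rule convergent_constant_coeff)
      show "0 \<le> coeff (poly_shift k (p n)) j" for n j by (simp add: coeff_poly_shift p)
      fix y :: real assume y: "0 < y" "y \<le> 1"
      have "poly (poly_shift k (p n)) y = (poly (p n) y - (\<Sum>j<k. coeff (p n) j * y ^ j)) / y ^ k" for n
        using poly_split_at[of "p n" y k] y by simp
      moreover have "(\<lambda>n. (poly (p n) y - (\<Sum>j<k. coeff (p n) j * y ^ j)) / y ^ k) \<longlonglongrightarrow>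
          (g y - (\<Sum>j<k. lim (\<lambda>n. coeff (p n) j) * y ^ j)) / y ^ k"
        using less y by (intro tendsto_intros lim) (auto simp: convergent_LIMSEQ_iff)
      ultimately show "convergent (\<lambda>n. poly (poly_shift k (p n)) y)"
        by (auto simp: convergent_def)
    qed
    then show ?case by (simp add: coeff_poly_shift)
  qed
  define c where "c = (\<lambda>k. lim (\<lambda>n. coeff (p n) k))"
  have c: "(\<lambda>n. coeff (p n) k) \<longlonglongrightarrow> c k" for k
    using conv by (simp add: c_def convergent_LIMSEQ_iff)
  have c0: "0 \<le> c k" for k using c[of k] p by (intro LIMSEQ_le_const) auto
  have "(\<lambda>k. c k * y ^ k) sums g y" if y: "0 \<le> y" "y < 1" for y
    unfolding sums_def
  proof (rule LIM_zero_cancel, rule Lim_null_comparison)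
    have L: "(\<lambda>n. poly (p n) y - (\<Sum>j<k. coeff (p n) j * y ^ j)) \<longlonglongrightarrow> g y - (\<Sum>j<k. c j * y ^ j)" for k
      using y by (intro tendsto_intros lim c) auto
    have "0 \<le> g y - (\<Sum>j<k. c j * y ^ j)" for k
      using L[of k] poly_tail_bounds(1)[OF p] y by (intro LIMSEQ_le_const) auto
    moreover have "g y - (\<Sum>j<k. c j * y ^ j) \<le> y ^ k * g 1" for k
    proof (rule LIMSEQ_le[OF L])
      show "(\<lambda>n. y ^ k * poly (p n) 1) \<longlonglongrightarrow> y ^ k * g 1" by (intro tendsto_intros lim) auto
    qed (use poly_tail_bounds(2)[OF p] y in auto)
    ultimately show "\<forall>\<^sub>F k in sequentially. norm ((\<Sum>j<k. c j * y ^ j) - g y) \<le> y ^ k * g 1"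
      by (intro always_eventually allI) (auto simp: abs_le_iff)
    show "(\<lambda>k. y ^ k * g 1) \<longlonglongrightarrow> 0"
      using y by (intro tendsto_mult_left_zero LIMSEQ_power_zero) auto
  qed
  with c0 show ?thesis by blast
qed

lemma power_series_deriv:
  assumes F: "\<And>x. 0 < x \<Longrightarrow> x < b \<Longrightarrow> (\<lambda>k. c k * x ^ k) sums F x"
    and x: "0 < x" "x < (b :: real)"
  shows "(F has_real_derivative (\<Sum>k. diffs c k * x ^ k)) (at x)"
    and "summable (\<lambda>k. diffs c k * x ^ k)"
proof -
  obtain K where K: "x < K" "K < b" using dense[OF x(2)] by blast
  then have sK: "summable (\<lambda>k. c k * K ^ k)"
    using F[of K] x by (auto simp: sums_iff)
  have "((\<lambda>x. \<Sum>k. c k * x ^ k) has_real_derivative (\<Sum>k. diffs c k * x ^ k)) (at x)"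
    using K x by (intro termdiffs_strong[OF sK]) simp
  then show "(F has_real_derivative (\<Sum>k. diffs c k * x ^ k)) (at x)"
    using x F by (elim has_field_derivative_transform_within_open[where S = "{0<..<b}"])
      (auto simp: sums_iff)
  show "summable (\<lambda>k. diffs c k * x ^ k)"
  proof (rule termdiff_converges)
    show "norm x < K" using K x by simp
    show "summable (\<lambda>k. c k * z ^ k)" if "norm z < K" for z
      using that by (intro powser_inside[OF sK]) simp
  qed
qed

lemma power_series_higher_derivs:
  assumes c: "\<And>k. 0 \<le> c k"
    and F: "\<And>x. 0 < x \<Longrightarrow> x < b \<Longrightarrow> (\<lambda>k. c k * x ^ k) sums F x"
    and x: "0 < x" "x < (b :: real)"
  shows "(deriv ^^ m) F differentiable (at x) \<and> 0 \<le> (deriv ^^ m) F x"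
  using c F
proof (induction m arbitrary: F c)
  case 0
  have "F differentiable (at x)"
    using power_series_deriv(1)[OF 0(2) x] by (auto simp: real_differentiable_def)
  moreover have "0 \<le> F x"
    by (rule sums_le[OF _ sums_zero 0(2)[OF x]]) (use 0(1) x in simp)
  ultimately show ?case by simp
next
  case (Suc m)
  have "(deriv ^^ m) (deriv F) differentiable (at x) \<and> 0 \<le> (deriv ^^ m) (deriv F) x"
  proof (rule Suc.IH)
    show "0 \<le> diffs c k" for k using Suc.prems(1) by (simp add: diffs_def)
    show "(\<lambda>k. diffs c k * y ^ k) sums deriv F y" if y: "0 < y" "y < b" for y
      using power_series_deriv[OF Suc.prems(2) y] by (simp add: DERIV_imp_deriv sums_iff)
  qed
  then show ?case by (simp only: funpow_Suc_right o_apply)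
qed

text \<open>Both properties are local. Near a point \<open>x\<close> below \<open>b\<close>, the approximation of \<open>F\<close> on \<open>[0, b]\<close> by
  polynomials with non-negative coefficients provides the power series.\<close>
lemma absolutely_monotonic_if_fdiffs_nonneg:
  assumes F: "\<And>b. 0 < b \<Longrightarrow> ereal b < \<rho> \<Longrightarrow> continuous_on {0..b} F \<and> fdiffs_nonneg b F"
  shows "absolutely_monotonic \<rho> F"
  unfolding absolutely_monotonic_def
proof (intro conjI allI impI)
  show "continuous_on (right_open_interval \<rho>) F"
    unfolding continuous_on_def
  proof
    fix x assume "x \<in> right_open_interval \<rho>"
    then have x: "0 \<le> x" "ereal x < \<rho>" by (auto simp: right_open_interval_def)
    then obtain b where b: "x < b" "ereal b < \<rho>" using ereal_dense2[of "ereal x" \<rho>] by auto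
    have "(F \<longlongrightarrow> F x) (at x within {0..b})"
      using F[of b] b x by (simp add: continuous_on_def)
    moreover have "at x within {0..b} = at x within right_open_interval \<rho>"
    proof (rule at_within_nhd[of x "{..<b}"])
      show "{0..b} \<inter> {..<b} - {x} = right_open_interval \<rho> \<inter> {..<b} - {x}"
        using b(2) by (auto simp: right_open_interval_def intro: order.strict_trans[of _ "ereal b"])
    qed (use b in auto)
    ultimately show "(F \<longlongrightarrow> F x) (at x within right_open_interval \<rho>)" by simp
  qed
next
  fix k and x :: real assume x: "0 < x \<and> ereal x < \<rho>"
  then obtain b where b: "x < b" "ereal b < \<rho>" using ereal_dense2[of "ereal x" \<rho>] by auto
  then have b0: "0 < b" and cont: "continuous_on {0..b} F" and fd: "fdiffs_nonneg b F"
    using F[of b] x by auto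
  obtain p :: "nat \<Rightarrow> real poly" where p: "\<And>n k. 0 \<le> coeff (p n) k"
    and lim: "\<And>x. x \<in> {0..b} \<Longrightarrow> (\<lambda>n. poly (p n) (x / b)) \<longlonglongrightarrow> F x"
    using nonneg_poly_approx[OF b0 cont fd] by blast
  have "(\<lambda>n. poly (p n) y) \<longlonglongrightarrow> F (b * y)" if "0 \<le> y" "y \<le> 1" for y
    using lim[of "b * y"] b0 that by (simp add: mult_left_le)
  from limit_of_nonneg_polys_power_series[OF p this] obtain c where
    c: "\<And>k. 0 \<le> c k" "\<And>y. 0 \<le> y \<Longrightarrow> y < 1 \<Longrightarrow> (\<lambda>k. c k * y ^ k) sums F (b * y)" by blast
  have "(deriv ^^ k) F differentiable (at x) \<and> 0 \<le> (deriv ^^ k) F x"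
  proof (rule power_series_higher_derivs[where c = "\<lambda>k. c k / b ^ k" and b = b])
    show "0 \<le> c k / b ^ k" for k using c(1) b0 by simp
    show "(\<lambda>k. c k / b ^ k * y ^ k) sums F y" if "0 < y" "y < b" for y
      using c(2)[of "y / b"] b0 that by (simp add: power_divide)
  qed (use x b in auto)
  then show "(deriv ^^ k) F differentiable (at x)" "0 \<le> (deriv ^^ k) F x" by auto
qed

section \<open>Continuity from small Hankel matrices\<close>

lemma preserves_positivity_mono:
  "preserves_positivity F (positive_hankel_matrices I) \<Longrightarrow> J \<subseteq> I \<Longrightarrow>
    preserves_positivity F (positive_hankel_matrices J)"
  by (auto simp: preserves_positivity_def positive_hankel_matrices_def positive_matrices_def)

text \<open>The parameters \<open>s0, \<dots>, s4\<close> are the antidiagonals of a Hankel matrix of size three, and the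
  two inequalities are the forms of this matrix and of its entrywise image at \<open>(a, b, c)\<close>.\<close>
lemma hankel_3_form:
  assumes F: "preserves_positivity F (positive_hankel_matrices I)"
    and s: "\<And>a b c :: real. 0 \<le> a\<^sup>2 * s0 + 2 * a * b * s1 + 2 * a * c * s2 + b\<^sup>2 * s2 + 2 * b * c * s3 + c\<^sup>2 * s4"
    and I: "s0 \<in> I" "s1 \<in> I" "s2 \<in> I" "s3 \<in> I" "s4 \<in> I"
  shows "0 \<le> a\<^sup>2 * F s0 + 2 * a * b * F s1 + 2 * a * c * F s2 + b\<^sup>2 * F s2 + 2 * b * c * F s3 + c\<^sup>2 * F s4"
proof -
  define s where "s = nth [s0, s1, s2, s3, s4]"
  have form: "(\<Sum>i<3. \<Sum>j<3. v i * v j * G (s (i + j))) =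
      (v 0)\<^sup>2 * G s0 + 2 * v 0 * v 1 * G s1 + 2 * v 0 * v 2 * G s2 + (v 1)\<^sup>2 * G s2
        + 2 * v 1 * v 2 * G s3 + (v 2)\<^sup>2 * G s4" for v and G :: "real \<Rightarrow> real"
    by (simp add: numeral_3_eq_3 numeral_2_eq_2 s_def power2_eq_square)
  have "psd 3 (\<lambda>i j. s (i + j))"
    unfolding psd_def using form[of _ "\<lambda>x. x"] s by (simp add: add.commute)
  moreover have "s (i + j) \<in> I" if "i < 3" "j < 3" for i j
  proof -
    have "i + j < length [s0, s1, s2, s3, s4]" using that by simp
    then have "s (i + j) \<in> set [s0, s1, s2, s3, s4]" unfolding s_def by (rule nth_mem)
    then show ?thesis using I by auto
  qed
  ultimately have "psd 3 (\<lambda>i j. F (s (i + j)))"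
    by (rule preserves_positivity_hankelD[OF F])
  from psd_form_nonneg[OF this, of "nth [a, b, c]"] show ?thesis
    unfolding form by simp
qed

lemma hankel_2_form:
  assumes F: "preserves_positivity F (positive_hankel_matrices I)"
    and s: "\<And>a b :: real. 0 \<le> a\<^sup>2 * s0 + 2 * a * b * s1 + b\<^sup>2 * s2"
    and I: "s0 \<in> I" "s1 \<in> I" "s2 \<in> I"
  shows "0 \<le> a\<^sup>2 * F s0 + 2 * a * b * F s1 + b\<^sup>2 * F s2"
proof -
  define s where "s = nth [s0, s1, s2]"
  have form: "(\<Sum>i<2. \<Sum>j<2. v i * v j * G (s (i + j))) =
      (v 0)\<^sup>2 * G s0 + 2 * v 0 * v 1 * G s1 + (v 1)\<^sup>2 * G s2" for v and G :: "real \<Rightarrow> real"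
    by (simp add: numeral_2_eq_2 s_def power2_eq_square)
  have "psd 2 (\<lambda>i j. s (i + j))"
    unfolding psd_def using form[of _ "\<lambda>x. x"] s by (simp add: add.commute)
  moreover have "s (i + j) \<in> I" if "i < 2" "j < 2" for i j
  proof -
    have "i + j < length [s0, s1, s2]" using that by simp
    then have "s (i + j) \<in> set [s0, s1, s2]" unfolding s_def by (rule nth_mem)
    then show ?thesis using I by auto
  qed
  ultimately have "psd 2 (\<lambda>i j. F (s (i + j)))"
    by (rule preserves_positivity_hankelD[OF F])
  from psd_form_nonneg[OF this, of "nth [a, b]"] show ?thesis
    unfolding form by simp
qed

lemma hankel_nonneg:
  assumes F: "preserves_positivity F (positive_hankel_matrices I)" and "x \<in> I" "0 \<le> x"
  shows "0 \<le> F x"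
proof -
  have "a\<^sup>2 * x + 2 * a * b * x + b\<^sup>2 * x = x * (a + b)\<^sup>2" for a b
    by (simp add: power2_eq_square algebra_simps)
  then show ?thesis
    using hankel_2_form[OF F, of x x x 1 0] assms(2,3) by simp
qed

text \<open>The matrix with rows \<open>(y, x)\<close> and \<open>(x, y)\<close>, tested against \<open>(1, -1)\<close>.\<close>
lemma hankel_mono:
  assumes F: "preserves_positivity F (positive_hankel_matrices I)"
    and "x \<in> I" "y \<in> I" "0 \<le> x" "x \<le> y"
  shows "F x \<le> F y"
proof -
  have "a\<^sup>2 * y + 2 * a * b * x + b\<^sup>2 * y = x * (a + b)\<^sup>2 + (y - x) * (a\<^sup>2 + b\<^sup>2)" for a b
    by (simp add: power2_eq_square algebra_simps)
  then show ?thesis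
    using hankel_2_form[OF F, of y x y 1 "-1"] assms by simp
qed

text \<open>The rank-one matrix with rows \<open>(y, y q)\<close> and \<open>(y q, y q\<^sup>2)\<close>, tested against \<open>(1, -1)\<close>. Consequently
  the drops of \<open>F\<close> along a geometric progression with ratio \<open>q\<close> decrease.\<close>
lemma hankel_geometric_midconvex:
  assumes F: "preserves_positivity F (positive_hankel_matrices I)"
    and "0 \<le> y" "y \<in> I" "y * q \<in> I" "y * q * q \<in> I"
  shows "F (y * q) - F (y * q * q) \<le> F y - F (y * q)"
proof -
  have "a\<^sup>2 * y + 2 * a * b * (y * q) + b\<^sup>2 * (y * q * q) = y * (a + b * q)\<^sup>2" for a b
    by (simp add: power2_eq_square algebra_simps)
  then show ?thesis
    using hankel_2_form[OF F, of y "y * q" "y * q * q" 1 "-1"] assms by simp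
qed

text \<open>To compare \<open>F 0\<close> with nearby values one needs a positive Hankel matrix with a zero entry whose
  pattern of nonzero entries is not positive. The matrix with rows \<open>(2 e, e, e)\<close>, \<open>(e, e, 0)\<close>
  and \<open>(e, 0, e)\<close> is one; the test vector is \<open>(-2, 1, 1)\<close>.\<close>
lemma hankel_gap_at_zero:
  assumes F: "preserves_positivity F (positive_hankel_matrices I)"
    and "0 \<le> e" "0 \<in> I" "e \<in> I" "2 * e \<in> I"
  shows "F e - F 0 \<le> 2 * (F (2 * e) - F e)"
proof -
  have "a\<^sup>2 * (2 * e) + 2 * a * b * e + 2 * a * c * e + b\<^sup>2 * e + 2 * b * c * 0 + c\<^sup>2 * e
      = e * ((a + b)\<^sup>2 + (a + c)\<^sup>2)" for a b c
    by (simp add: power2_eq_square algebra_simps)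
  then have "0 \<le> a\<^sup>2 * (2 * e) + 2 * a * b * e + 2 * a * c * e + b\<^sup>2 * e + 2 * b * c * 0 + c\<^sup>2 * e" for a b c
    using assms(2) by simp
  from hankel_3_form[OF F this, of "-2" 1 1] show ?thesis using assms by simp
qed

text \<open>Drops of \<open>F\<close> between neighbouring terms of a geometric progression are small if many
  larger ones precede them. At \<open>x > 0\<close> the progression runs from \<open>c\<close> to \<open>x\<close> in \<open>n\<close> steps, and the drops
  on both sides of \<open>x\<close> control a neighbourhood of \<open>x\<close>. At \<open>0\<close> the progression has ratio \<open>1/2\<close> and
  \<open>hankel_gap_at_zero\<close> bounds the gap \<open>F h - F 0\<close> by twice each of the \<open>n\<close> drops before \<open>h\<close>.\<close>
lemma hankel_continuous:
  assumes F: "preserves_positivity F (positive_hankel_matrices {0..c})" and c: "0 < c"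
  shows "continuous_on {0..<c} F"
  unfolding continuous_on_def
proof
  have nonneg: "0 \<le> F x" if "0 \<le> x" "x \<le> c" for x
    using hankel_nonneg[OF F] that by simp
  have mono: "F x \<le> F y" if "0 \<le> x" "x \<le> y" "y \<le> c" for x y
    using hankel_mono[OF F] that by simp
  have pow: "0 \<le> c * q ^ k" "c * q ^ k \<le> c" if "0 \<le> q" "q \<le> 1" for q k
    using that c by (auto simp: power_le_one mult_left_le)
  \<comment> \<open>If \<open>n\<close> consecutive drops of \<open>F\<close> along a geometric progression starting at \<open>c\<close> are at least \<open>d\<close>,
    then \<open>n * d\<close> is at most the total drop, which is at most \<open>F c\<close>. Every small jump estimate below
    comes from this by taking \<open>n\<close> large.\<close>
  have tele: "real n * d \<le> F c" if "0 \<le> q" "q \<le> 1" "\<And>k. k < n \<Longrightarrow> d \<le> F (c * q ^ k) - F (c * q ^ Suc k)"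
    for n d and q :: real
  proof -
    have "real n * d = (\<Sum>k<n. d)" by simp
    also have "\<dots> \<le> (\<Sum>k<n. F (c * q ^ k) - F (c * q ^ Suc k))"
      using that(3) by (intro sum_mono) auto
    also have "\<dots> = F c - F (c * q ^ n)"
      using sum_lessThan_telescope'[of "\<lambda>k. F (c * q ^ k)" n] by simp
    also have "\<dots> \<le> F c" using nonneg[OF pow] that by simp
    finally show ?thesis .
  qed
  fix x assume "x \<in> {0..<c}"
  then have x: "0 \<le> x" "x < c" by auto
  show "(F \<longlongrightarrow> F x) (at x within {0..<c})"
  proof (rule tendstoI)
    fix e :: real assume e: "0 < e"
    obtain n0 where n0: "2 * F c / e < real n0" using reals_Archimedean2 by blast
    define n where "n = Suc n0"
    have n: "0 < n" "2 * F c < real n * e"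
      using n0 e by (auto simp: n_def field_simps intro: order.strict_trans)
    show "\<forall>\<^sub>F y in at x within {0..<c}. dist (F y) (F x) < e"
    proof (cases "x = 0")
      case True
      define h where "h = c * (1 / 2) ^ n"
      have h: "0 < h" "h \<le> c" using c pow[of "1/2" n] by (auto simp: h_def)
      have "real n * ((F h - F 0) / 2) \<le> F c"
      proof (rule tele[of "1/2"])
        fix k assume "k < n"
        define u where "u = c * (1 / 2) ^ Suc k"
        have "0 \<le> u" "2 * u = c * (1 / 2) ^ k"
          using c by (auto simp: u_def)
        moreover have "c * (1 / 2) ^ k \<le> c" by (rule pow) auto
        ultimately have u: "0 \<le> u" "2 * u = c * (1 / 2) ^ k" "2 * u \<le> c" "u \<le> c" by auto
        have "(1 / 2 :: real) ^ n \<le> (1 / 2) ^ Suc k"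
          using \<open>k < n\<close> by (intro power_decreasing) auto
        then have "h \<le> u" unfolding h_def u_def using c by (intro mult_left_mono) auto
        then have "F h \<le> F u" using u h by (intro mono) auto
        then have "(F h - F 0) / 2 \<le> F (2 * u) - F u"
          using hankel_gap_at_zero[OF F, of u] u c by auto
        then show "(F h - F 0) / 2 \<le> F (c * (1 / 2) ^ k) - F (c * (1 / 2) ^ Suc k)"
          unfolding u(2) unfolding u_def .
      qed auto
      then have "real n * (F h - F 0) < real n * e" using n by (simp add: field_simps)
      then have lt: "F h - F 0 < e" using n(1) by simp
      have "\<forall>\<^sub>F y in nhds x. y < h"
        using h True by (intro eventually_nhds_in_open[of "{..<h}", simplified]) auto
      then show ?thesis unfolding eventually_at_filter
      proof eventually_elim
        case (elim y)
        then show ?case using mono[of y h] mono[of 0 y] lt h True by (auto simp: dist_real_def)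
      qed
    next
      case False
      then have x0: "0 < x" using x by simp
      define q where "q = root n (x / c)"
      have q: "0 < q" "q < 1" "q ^ n = x / c"
        using x0 x c n(1) by (auto simp: q_def real_root_lt_1_iff real_root_pow_pos2)
      have xq: "c * q ^ n = x" using q c by simp
      define d where "d = (\<lambda>k. F (c * q ^ k) - F (c * q ^ Suc k))"
      have "d (Suc k) \<le> d k" for k
        using hankel_geometric_midconvex[OF F, of "c * q ^ k" q] pow[of q k] pow[of q "Suc k"]
          pow[of q "Suc (Suc k)"] q by (simp add: d_def ac_simps)
      then have dec: "d k \<le> d j" if "j \<le> k" for j k
        using decseqD[of d j k] that by (auto simp: decseq_Suc_iff)
      have "real n * d n0 \<le> F c"
      proof (rule tele[of q])
        fix k assume "k < n"
        then show "d n0 \<le> F (c * q ^ k) - F (c * q ^ Suc k)"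
          using dec[of k n0] unfolding d_def n_def by simp
      qed (use q in auto)
      then have "real n * d n0 < real n * e"
        using n nonneg[of c] c by linarith
      then have dn: "d n0 < e" "d n < e"
        using n(1) dec[of n0 n] by (auto simp: n_def)
      have up: "c * q ^ n0 = x / q" using xq q by (simp add: n_def field_simps)
      have down: "c * q ^ Suc n = x * q" using xq by (simp add: ac_simps)
      have b: "x * q < x" "x < x / q" "x / q \<le> c"
        using q x0 pow[of q n0] up by (auto simp: field_simps)
      have "\<forall>\<^sub>F y in nhds x. y \<in> {x * q<..<x / q}"
        using b by (intro eventually_nhds_in_open) auto
      then show ?thesis unfolding eventually_at_filter
      proof eventually_elim
        case (elim y)
        have 1: "F (x / q) - F x < e" "F x - F (x * q) < e"
          using dn unfolding d_def up[symmetric] down[symmetric] n_def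
          unfolding n_def[symmetric] xq by simp_all
        have "0 \<le> x * q" using x0 q by simp
        then have "F (x * q) \<le> F y" "F y \<le> F (x / q)" using elim b by (auto intro!: mono)
        with 1 show ?case by (auto simp: dist_real_def)
      qed
    qed
  qed
qed

section \<open>Forward differences from large Hankel matrices\<close>

text \<open>Positivity of the Hankel matrices of the measures \<open>a \<delta>\<^sub>1 + t \<delta>\<^bsub>1/2\<^esub>\<close> after applying \<open>f\<close>. This
  family is closed under adding a non-negative constant to all entries, so the condition survives
  integrating translates of \<open>f\<close>. What matters about \<open>1/2\<close> is that its powers are positive and distinct.\<close>
definition hankel_form_nonneg :: "real \<Rightarrow> (real \<Rightarrow> real) \<Rightarrow> bool" where
  "hankel_form_nonneg b f \<longleftrightarrow> (\<forall>a t n v. 0 \<le> a \<longrightarrow> 0 \<le> t \<longrightarrow> a + t \<le> b \<longrightarrow>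
     0 \<le> (\<Sum>i<n. \<Sum>j<n. v i * v j * f (a + t * (1 / 2) ^ (i + j))))"

lemma hankel_form_nonnegD:
  "hankel_form_nonneg b f \<Longrightarrow> 0 \<le> a \<Longrightarrow> 0 \<le> t \<Longrightarrow> a + t \<le> b \<Longrightarrow>
     0 \<le> (\<Sum>i<n. \<Sum>j<n. v i * v j * f (a + t * (1 / 2) ^ (i + j)))"
  unfolding hankel_form_nonneg_def by blast

lemma hankel_form_nonneg_if_preserves:
  assumes F: "preserves_positivity F (positive_hankel_matrices {0..b})"
    and fF: "\<And>x. 0 \<le> x \<Longrightarrow> x \<le> b \<Longrightarrow> f x = F x"
  shows "hankel_form_nonneg b f"
  unfolding hankel_form_nonneg_def
proof (intro allI impI)
  fix a t :: real and n :: nat and v :: "nat \<Rightarrow> real"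
  assume a: "0 \<le> a" and t: "0 \<le> t" and b: "a + t \<le> b"
  define s where "s = (\<lambda>k :: nat. a + t * (1 / 2) ^ k)"
  have s: "0 \<le> s k" "s k \<le> b" for k
  proof -
    have "t * (1 / 2) ^ k \<le> t" using t by (simp add: mult_left_le power_le_one)
    then show "0 \<le> s k" "s k \<le> b" using a t b by (auto simp: s_def)
  qed
  have "(\<Sum>i<n. \<Sum>j<n. w i * w j * s (i + j)) =
      a * (\<Sum>i<n. w i)\<^sup>2 + t * (\<Sum>i<n. w i * (1 / 2) ^ i)\<^sup>2" for w
  proof -
    have "(\<Sum>i<n. w i)\<^sup>2 = (\<Sum>i<n. \<Sum>j<n. w i * w j)"
      using rank_one_form[of w "\<lambda>_. 1" n] by simp
    then show ?thesis
      unfolding rank_one_form[symmetric] sum_distrib_left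
      by (simp add: sum_distrib_left sum.distrib[symmetric] s_def power_add algebra_simps)
  qed
  then have "psd n (\<lambda>i j. s (i + j))"
    unfolding psd_def using a t by (simp add: add.commute)
  then have "psd n (\<lambda>i j. F (s (i + j)))"
    by (rule preserves_positivity_hankelD[OF F]) (use s in auto)
  then have "0 \<le> (\<Sum>i<n. \<Sum>j<n. v i * v j * F (s (i + j)))" by (rule psd_form_nonneg)
  then show "0 \<le> (\<Sum>i<n. \<Sum>j<n. v i * v j * f (a + t * (1 / 2) ^ (i + j)))"
    using fF s unfolding s_def by simp
qed

lemma DERIV_fdiff_funpow:
  assumes "\<And>x. (g has_real_derivative g' x) (at x)"
  shows "((fdiff h ^^ m) g has_real_derivative (fdiff h ^^ m) g' x) (at x)"
proof (induction m arbitrary: x)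
  case (Suc m)
  have "((\<lambda>x. (fdiff h ^^ m) g (x + h)) has_real_derivative (fdiff h ^^ m) g' (x + h)) (at x)"
    using Suc.IH[of "x + h"] by (simp add: DERIV_shift)
  then have "((\<lambda>x. (fdiff h ^^ m) g (x + h) - (fdiff h ^^ m) g x) has_real_derivative
      (fdiff h ^^ m) g' (x + h) - (fdiff h ^^ m) g' x) (at x)"
    by (intro DERIV_diff Suc.IH)
  then show ?case by (simp only: fdiff_Suc[abs_def])
qed (use assms in simp)

text \<open>With an antiderivative \<open>\<Phi>\<close> of \<open>f\<close>, take \<open>g x = \<Phi> (x + h) - \<Phi> x\<close>, the integral of \<open>f\<close> over the window
  \<open>[x, x + h]\<close>. The form for \<open>g\<close> is the increment over \<open>[0, h]\<close> of a function whose derivative, a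
  form for \<open>f\<close> with \<open>a\<close> shifted, is non-negative.\<close>
lemma box_mollify:
  assumes f: "continuous_on UNIV f" and F: "hankel_form_nonneg b f" and h: "0 < h"
  shows "\<exists>g. (\<forall>x. (g has_real_derivative fdiff h f x) (at x)) \<and> hankel_form_nonneg (b - h) g"
proof -
  have "\<exists>\<Phi>. \<forall>x. ereal x > -\<infinity> \<longrightarrow> ereal x < \<infinity> \<longrightarrow> (\<Phi> has_vector_derivative f x) (at x)"
    using f by (intro einterval_antiderivative) (auto simp: continuous_on_eq_continuous_at)
  then obtain \<Phi> where \<Phi>: "\<And>x. (\<Phi> has_real_derivative f x) (at x)"
    by (auto simp: has_real_derivative_iff_has_vector_derivative)
  define g where "g = (\<lambda>x. \<Phi> (x + h) - \<Phi> x)"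
  have "(g has_real_derivative fdiff h f x) (at x)" for x
    unfolding g_def fdiff_def
    using \<Phi>[of "x + h"] by (intro DERIV_diff \<Phi>) (simp add: DERIV_shift)
  moreover have "hankel_form_nonneg (b - h) g"
    unfolding hankel_form_nonneg_def
  proof (intro allI impI)
    fix a t :: real and n :: nat and v :: "nat \<Rightarrow> real"
    assume a: "0 \<le> a" and t: "0 \<le> t" and b: "a + t \<le> b - h"
    define S where "S = (\<lambda>\<phi> r. \<Sum>i<n. \<Sum>j<n. v i * v j * \<phi> (a + t * (1 / 2) ^ (i + j) + r))"
    have "(S \<Phi> has_real_derivative S f r) (at r)" for r
      unfolding S_def
    proof (intro DERIV_sum DERIV_cmult)
      fix i j
      show "((\<lambda>r. \<Phi> (a + t * (1 / 2) ^ (i + j) + r)) has_real_derivative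
          f (a + t * (1 / 2) ^ (i + j) + r)) (at r)"
        using \<Phi>[of "r + (a + t * (1 / 2) ^ (i + j))"]
        by (simp only: DERIV_shift add.commute)
    qed
    moreover have "0 \<le> S f r" if "0 \<le> r" "r \<le> h" for r
      using hankel_form_nonnegD[OF F, of "a + r" t v n] a t b that
      by (simp add: S_def add.assoc add.commute add.left_commute)
    ultimately have "S \<Phi> 0 \<le> S \<Phi> h"
      using h by (intro DERIV_nonneg_imp_nondecreasing[where f = "S \<Phi>"]) auto
    then show "0 \<le> (\<Sum>i<n. \<Sum>j<n. v i * v j * g (a + t * (1 / 2) ^ (i + j)))"
      by (simp add: S_def g_def right_diff_distrib sum_subtractf)
  qed
  ultimately show ?thesis by blast
qed

text \<open>Each integration over a window trades one derivative for one forward difference, so after \<open>m\<close> of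
  them the \<open>m\<close>-th derivative exists and equals the \<open>m\<close>-th forward difference of the original function.\<close>
lemma iterated_mollify:
  assumes "continuous_on UNIV f" "hankel_form_nonneg b f" and h: "0 < h"
  shows "\<exists>D :: nat \<Rightarrow> real \<Rightarrow> real. (\<forall>k<m. \<forall>x. (D k has_real_derivative D (Suc k) x) (at x)) \<and>
    D m = (fdiff h ^^ m) f \<and> hankel_form_nonneg (b - real m * h) (D 0)"
  using assms(1,2)
proof (induction m arbitrary: f b)
  case 0
  then show ?case by (intro exI[of _ "\<lambda>_. f"]) simp
next
  case (Suc m)
  obtain g where g: "\<And>x. (g has_real_derivative fdiff h f x) (at x)" "hankel_form_nonneg (b - h) g"
    using box_mollify[OF Suc.prems h] by blast
  have "continuous_on UNIV g"
    using g(1) by (intro DERIV_continuous_on) (auto intro: has_field_derivative_at_within)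
  from Suc.IH[OF this g(2)] obtain D :: "nat \<Rightarrow> real \<Rightarrow> real"
    where D: "\<And>k x. k < m \<Longrightarrow> (D k has_real_derivative D (Suc k) x) (at x)"
      "D m = (fdiff h ^^ m) g" "hankel_form_nonneg (b - h - real m * h) (D 0)" by blast
  define E where "E = D(Suc m := (fdiff h ^^ m) (fdiff h f))"
  have "(E k has_real_derivative E (Suc k) x) (at x)" if "k < Suc m" for k x
  proof (cases "k = m")
    case True
    then show ?thesis using DERIV_fdiff_funpow[OF g(1)] by (simp add: E_def D(2))
  next
    case False
    then show ?thesis using that D(1) by (simp add: E_def)
  qed
  moreover have "E (Suc m) = (fdiff h ^^ Suc m) f" by (simp only: E_def fdiff_Suc' fun_upd_same)
  moreover have "hankel_form_nonneg (b - real (Suc m) * h) (E 0)"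
    using D(3) by (simp add: E_def algebra_simps)
  ultimately show ?case by blast
qed

text \<open>Taylor's theorem with the remainder in Peano's form.\<close>
lemma tendsto_taylor_quotient:
  fixes D :: "nat \<Rightarrow> real \<Rightarrow> real"
  assumes D: "\<And>k x. k < m \<Longrightarrow> (D k has_real_derivative D (Suc k) x) (at x)"
    and cont: "isCont (D m) a"
  shows "((\<lambda>y. (D 0 (a + y) - (\<Sum>k<m. D k a / fact k * y ^ k)) / y ^ m) \<longlongrightarrow> D m a / fact m) (at_right 0)"
proof (rule tendstoI)
  fix e :: real assume e: "0 < e"
  have "((\<lambda>z. D m z / fact m) \<longlongrightarrow> D m a / fact m) (at a)"
    using cont by (intro tendsto_intros) (auto simp: isCont_def)
  from tendstoD[OF this e] obtain d where d: "0 < d"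
    "\<And>z. z \<noteq> a \<Longrightarrow> dist z a < d \<Longrightarrow> dist (D m z / fact m) (D m a / fact m) < e"
    by (auto simp: eventually_at)
  have "dist ((D 0 (a + y) - (\<Sum>k<m. D k a / fact k * y ^ k)) / y ^ m) (D m a / fact m) < e"
    if y: "0 < y" "y < d" for y
  proof -
    have "\<exists>z. a < z \<and> z \<le> a + y \<and> D 0 (a + y) = (\<Sum>k<m. D k a / fact k * y ^ k) + D m z / fact m * y ^ m"
    proof (cases "m = 0")
      case True
      then show ?thesis using y by (intro exI[of _ "a + y"]) simp
    next
      case False
      then show ?thesis
        using Taylor_up[of m D "D 0" a "a + y" a] D y by auto
    qed
    then obtain z where z: "a < z" "z \<le> a + y"
      "D 0 (a + y) = (\<Sum>k<m. D k a / fact k * y ^ k) + D m z / fact m * y ^ m" by blast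
    then have "(D 0 (a + y) - (\<Sum>k<m. D k a / fact k * y ^ k)) / y ^ m = D m z / fact m"
      using y by simp
    then show ?thesis using d(2)[of z] z y by (simp add: dist_real_def)
  qed
  then show "\<forall>\<^sub>F y in at_right 0. dist ((D 0 (a + y) - (\<Sum>k<m. D k a / fact k * y ^ k)) / y ^ m) (D m a / fact m) < e"
    using d(1) by (auto simp: eventually_at_right_field)
qed

text \<open>Expanding the entries in powers of \<open>t\<close>, the form at the coefficient vector of a polynomial \<open>V\<close> has
  at \<open>t\<^sup>k\<close> the coefficient \<open>D k a / k! * V(2\<^bsup>-k\<^esup>)\<^sup>2\<close>. If \<open>V\<close> vanishes at \<open>2\<^bsup>-k\<^esup>\<close> for \<open>k < m\<close> but not
  at \<open>2\<^bsup>-m\<^esup>\<close>, the term of order \<open>m\<close> dominates as \<open>t\<close> tends to \<open>0\<close> and determines the sign.\<close>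
lemma derivative_nonneg_if_hankel_form:
  fixes D :: "nat \<Rightarrow> real \<Rightarrow> real"
  assumes D: "\<And>k x. k < m \<Longrightarrow> (D k has_real_derivative D (Suc k) x) (at x)"
    and cont: "isCont (D m) a"
    and form: "hankel_form_nonneg c (D 0)" and a: "0 \<le> a" "a < c"
  shows "0 \<le> D m a"
proof -
  define u :: real where "u = 1 / 2"
  define V where "V = (\<Prod>k<m. [:- (u ^ k), 1:])"
  define N where "N = Suc (degree V)"
  define v where "v = coeff V"
  define r where "r = (\<lambda>y. (D 0 (a + y) - (\<Sum>k<m. D k a / fact k * y ^ k)) / y ^ m)"
  have moment: "(\<Sum>i<N. \<Sum>j<N. v i * v j * u ^ ((i + j) * k)) = (poly V (u ^ k))\<^sup>2" for k
  proof -
    have "u ^ ((i + j) * k) = (u ^ k) ^ i * (u ^ k) ^ j" for i j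
      by (simp only: power_mult[symmetric] power_add[symmetric] distrib_left mult.commute)
    then have "(\<Sum>i<N. \<Sum>j<N. v i * v j * u ^ ((i + j) * k)) = (\<Sum>i<N. v i * (u ^ k) ^ i)\<^sup>2"
      by (simp only: rank_one_form)
    then show ?thesis by (simp add: N_def v_def poly_altdef lessThan_Suc_atMost)
  qed
  have zero: "poly V (u ^ k) = 0" if "k < m" for k
    unfolding V_def poly_prod using that by (intro prod_zero) auto
  have nonzero: "poly V (u ^ m) \<noteq> 0"
  proof -
    have "u ^ m \<noteq> u ^ k" if "k < m" for k
    proof -
      have "u ^ m < u ^ k" by (rule power_strict_decreasing[OF that]) (auto simp: u_def)
      then show ?thesis by simp
    qed
    then show ?thesis by (auto simp: V_def poly_prod)
  qed
  have rem: "0 \<le> (\<Sum>i<N. \<Sum>j<N. v i * v j * (u ^ ((i + j) * m) * r (t * u ^ (i + j))))"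
    if t: "0 < t" "t < c - a" for t
  proof -
    have expand: "D 0 (a + t * u ^ n) =
        (\<Sum>k<m. (D k a / fact k * t ^ k) * u ^ (n * k)) + t ^ m * (u ^ (n * m) * r (t * u ^ n))" for n
    proof -
      have "t * u ^ n \<noteq> 0" using t by (simp add: u_def)
      then have "D 0 (a + t * u ^ n) = (\<Sum>k<m. D k a / fact k * (t * u ^ n) ^ k)
          + (t * u ^ n) ^ m * r (t * u ^ n)"
        by (simp add: r_def)
      then show ?thesis by (simp only: power_mult_distrib power_mult[symmetric] mult.assoc)
    qed
    have "0 \<le> (\<Sum>i<N. \<Sum>j<N. v i * v j * D 0 (a + t * u ^ (i + j)))"
      unfolding u_def using t a by (intro hankel_form_nonnegD[OF form]) auto
    also have "\<dots> = (\<Sum>i<N. \<Sum>j<N. \<Sum>k<m. (D k a / fact k * t ^ k) * (v i * v j * u ^ ((i + j) * k)))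
        + t ^ m * (\<Sum>i<N. \<Sum>j<N. v i * v j * (u ^ ((i + j) * m) * r (t * u ^ (i + j))))"
      unfolding expand distrib_left sum.distrib sum_distrib_left
      by (intro arg_cong2[where f = "(+)"] sum.cong refl) (simp_all only: ac_simps)
    also have "(\<Sum>i<N. \<Sum>j<N. \<Sum>k<m. (D k a / fact k * t ^ k) * (v i * v j * u ^ ((i + j) * k)))
        = (\<Sum>i<N. \<Sum>k<m. \<Sum>j<N. (D k a / fact k * t ^ k) * (v i * v j * u ^ ((i + j) * k)))"
      by (intro sum.cong refl sum.swap)
    also have "\<dots> = (\<Sum>k<m. \<Sum>i<N. \<Sum>j<N. (D k a / fact k * t ^ k) * (v i * v j * u ^ ((i + j) * k)))"
      by (rule sum.swap)
    also have "\<dots> = (\<Sum>k<m. (D k a / fact k * t ^ k) * (poly V (u ^ k))\<^sup>2)"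
      unfolding moment[symmetric] sum_distrib_left ..
    also have "\<dots> = 0" using zero by (intro sum.neutral) auto
    finally show ?thesis using t by (intro mult_left_le_imp_le[of "t ^ m" 0]) simp_all
  qed
  have r_lim: "(r \<longlongrightarrow> D m a / fact m) (at_right 0)"
    unfolding r_def by (rule tendsto_taylor_quotient[OF D cont])
  have scaled: "((\<lambda>t. r (t * u ^ n)) \<longlongrightarrow> D m a / fact m) (at_right 0)" for n
  proof (rule filterlim_compose[OF r_lim])
    have "((\<lambda>t. t * u ^ n) \<longlongrightarrow> 0) (at_right 0)" by (auto intro!: tendsto_eq_intros)
    moreover have "\<forall>\<^sub>F t in at_right 0. t * u ^ n \<in> {0<..} \<and> t * u ^ n \<noteq> 0"
      by (auto simp: eventually_at_right_field u_def intro: exI[of _ 1])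
    ultimately show "filterlim (\<lambda>t. t * u ^ n) (at_right 0) (at_right 0)"
      by (simp add: filterlim_at)
  qed
  have "((\<lambda>t. \<Sum>i<N. \<Sum>j<N. v i * v j * (u ^ ((i + j) * m) * r (t * u ^ (i + j)))) \<longlongrightarrow>
      (\<Sum>i<N. \<Sum>j<N. v i * v j * (u ^ ((i + j) * m) * (D m a / fact m)))) (at_right 0)"
    by (intro tendsto_intros scaled)
  moreover have "(\<Sum>i<N. \<Sum>j<N. v i * v j * (u ^ ((i + j) * m) * (D m a / fact m)))
      = (poly V (u ^ m))\<^sup>2 * (D m a / fact m)"
    unfolding moment[symmetric] sum_distrib_right by (simp only: mult.assoc)
  moreover have "\<forall>\<^sub>F t in at_right 0. 0 \<le> (\<Sum>i<N. \<Sum>j<N. v i * v j * (u ^ ((i + j) * m) * r (t * u ^ (i + j))))"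
    using rem a by (auto simp: eventually_at_right_field intro!: exI[of _ "c - a"])
  ultimately have "0 \<le> (poly V (u ^ m))\<^sup>2 * (D m a / fact m)"
    by (intro tendsto_lowerbound[where F = "at_right (0 :: real)"]) auto
  then have "0 \<le> (poly V (u ^ m))\<^sup>2 / fact m * D m a" by simp
  moreover have "0 < (poly V (u ^ m))\<^sup>2 / fact m" using nonzero by simp
  ultimately show ?thesis
    using mult_pos_neg[of "(poly V (u ^ m))\<^sup>2 / fact m" "D m a"] by linarith
qed

text \<open>Integration over windows needs a function on the whole line, so \<open>F\<close> is extended by constants from an interval
  \<open>[0, d]\<close> on which it is continuous; the choice \<open>b < d\<close> keeps the base point \<open>x\<close> strictly inside the
  interval that remains after \<open>m\<close> integrations.\<close>
lemma hankel_fdiffs_nonneg: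
  assumes F: "preserves_positivity F (positive_hankel_matrices {0..c})" and b: "0 < b" "b < c"
  shows "continuous_on {0..b} F" "fdiffs_nonneg b F"
proof -
  have cont: "continuous_on {0..<c} F" using hankel_continuous[OF F] b by simp
  then show "continuous_on {0..b} F" by (rule continuous_on_subset) (use b in auto)
  obtain d where d: "b < d" "d < c" using dense[OF b(2)] by blast
  define f where "f = (\<lambda>x. F (max 0 (min d x)))"
  have f: "continuous_on UNIV f"
    unfolding f_def using b d
    by (intro continuous_on_compose2[OF cont] continuous_intros) auto
  have form: "hankel_form_nonneg d f"
  proof (rule hankel_form_nonneg_if_preserves)
    show "preserves_positivity F (positive_hankel_matrices {0..d})"
      by (rule preserves_positivity_mono[OF F]) (use d in auto)
  qed (simp add: f_def)
  show "fdiffs_nonneg b F"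
    unfolding fdiffs_nonneg_def
  proof (intro allI impI)
    fix m :: nat and h x :: real
    assume h: "0 < h" and x: "0 \<le> x" "x + real m * h \<le> b"
    obtain D :: "nat \<Rightarrow> real \<Rightarrow> real"
      where D: "\<And>k x. k < m \<Longrightarrow> (D k has_real_derivative D (Suc k) x) (at x)"
        "D m = (fdiff h ^^ m) f" "hankel_form_nonneg (d - real m * h) (D 0)"
      using iterated_mollify[OF f form h, of m] by blast
    have "continuous_on UNIV ((fdiff h ^^ m) f)"
    proof (induction m)
      case (Suc m)
      have "continuous_on UNIV (\<lambda>x. (fdiff h ^^ m) f (x + h))"
        by (rule continuous_on_compose2[OF Suc.IH]) (auto intro!: continuous_intros)
      then show ?case unfolding fdiff_Suc[abs_def] by (intro continuous_on_diff Suc.IH)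
    qed (use f in simp)
    then have "isCont (D m) x" by (simp add: D(2) continuous_on_eq_continuous_at)
    then have "0 \<le> D m x"
      using derivative_nonneg_if_hankel_form[OF D(1) _ D(3)] x d by simp
    also have "D m x = (fdiff h ^^ m) F x"
      unfolding D(2) using x d h by (intro fdiff_cong) (auto simp: f_def)
    finally show "0 \<le> (fdiff h ^^ m) F x" .
  qed
qed

section \<open>The equivalences\<close>

lemma right_open_interval_ereal: "right_open_interval (ereal \<rho>) = {0..<\<rho>}"
  by (auto simp: right_open_interval_def)

lemma absolutely_monotonic_if_preserves_hankel:
  assumes F: "preserves_positivity F (positive_hankel_matrices (right_open_interval \<rho>))"
  shows "absolutely_monotonic \<rho> F"
proof (rule absolutely_monotonic_if_fdiffs_nonneg)
  fix b assume b: "0 < b" "ereal b < \<rho>"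
  then obtain c where c: "b < c" "ereal c < \<rho>" using ereal_dense2[of "ereal b" \<rho>] by auto
  have "{0..c} \<subseteq> right_open_interval \<rho>"
    using c(2) by (auto simp: right_open_interval_def intro: order.strict_trans1[of _ "ereal c"])
  then have "preserves_positivity F (positive_hankel_matrices {0..c})"
    by (rule preserves_positivity_mono[OF F])
  from hankel_fdiffs_nonneg[OF this b(1) c(1)] show "continuous_on {0..b} F \<and> fdiffs_nonneg b F"
    by blast
qed

text \<open>\<open>F\<close> is nondecreasing up to and including \<open>\<rho>\<close>.\<close>
lemma left_limit_if_preserves_hankel:
  assumes F: "preserves_positivity F (positive_hankel_matrices {0..\<rho>})" and \<rho>: "0 < \<rho>"
  shows "\<exists>L. (F \<longlongrightarrow> L) (at_left \<rho>) \<and> L \<le> F \<rho>"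
proof -
  have mono: "F x \<le> F y" if "0 \<le> x" "x \<le> y" "y \<le> \<rho>" for x y
    using hankel_mono[OF F] that by simp
  define L where "L = Sup (F ` ({..<\<rho>} \<inter> {0..}))"
  have "(F \<longlongrightarrow> L) (at \<rho> within ({..<\<rho>} \<inter> {0..}))"
    unfolding L_def by (rule Lim_left_bound[where K = "F \<rho>"]) (auto intro: mono)
  moreover have "at \<rho> within ({..<\<rho>} \<inter> {0..}) = at_left \<rho>"
    using \<rho> by (intro at_within_nhd[of \<rho> "{0<..}"]) auto
  moreover have "L \<le> F \<rho>"
    unfolding L_def using \<rho> by (intro cSup_least) (auto intro: mono)
  ultimately show ?thesis by auto
qed

lemma preserves_positivity_hankel_if_all:
  "preserves_positivity F (positive_matrices I) \<Longrightarrow>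
    preserves_positivity F (positive_hankel_matrices I)"
  by (auto simp: preserves_positivity_def positive_hankel_matrices_def)

theorem proposition8p1:
  fixes F :: "real \<Rightarrow> real"
  shows
    "(\<forall>\<rho>::real. 0 < \<rho> \<longrightarrow>
        (preserves_positivity F (positive_hankel_matrices {0..\<rho>}) \<longleftrightarrow>
           absolutely_monotonic (ereal \<rho>) F \<and> (\<exists>L. (F \<longlongrightarrow> L) (at_left \<rho>) \<and> L \<le> F \<rho>)) \<and>
        (absolutely_monotonic (ereal \<rho>) F \<and> (\<exists>L. (F \<longlongrightarrow> L) (at_left \<rho>) \<and> L \<le> F \<rho>) \<longleftrightarrow>
           preserves_positivity F (positive_matrices {0..\<rho>}))) \<and>
     (\<forall>\<rho>::ereal. 0 < \<rho> \<longrightarrow>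
        (preserves_positivity F (positive_hankel_matrices (right_open_interval \<rho>)) \<longleftrightarrow>
           absolutely_monotonic \<rho> F) \<and>
        (absolutely_monotonic \<rho> F \<longleftrightarrow>
           preserves_positivity F (positive_matrices (right_open_interval \<rho>))))"
proof (intro conjI allI impI)
  fix \<rho> :: real assume \<rho>: "0 < \<rho>"
  let ?hankel = "preserves_positivity F (positive_hankel_matrices {0..\<rho>})"
  let ?am = "absolutely_monotonic (ereal \<rho>) F \<and> (\<exists>L. (F \<longlongrightarrow> L) (at_left \<rho>) \<and> L \<le> F \<rho>)"
  let ?all = "preserves_positivity F (positive_matrices {0..\<rho>})"
  have "?am" if ?hankel
  proof
    have "preserves_positivity F (positive_hankel_matrices (right_open_interval (ereal \<rho>)))"
      by (rule preserves_positivity_mono[OF that]) (auto simp: right_open_interval_ereal)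
    then show "absolutely_monotonic (ereal \<rho>) F"
      by (rule absolutely_monotonic_if_preserves_hankel)
    show "\<exists>L. (F \<longlongrightarrow> L) (at_left \<rho>) \<and> L \<le> F \<rho>"
      by (rule left_limit_if_preserves_hankel[OF that \<rho>])
  qed
  moreover have ?all if ?am
    using that \<rho> by (auto intro: preserves_positivity_closed)
  moreover have ?hankel if ?all
    using that by (rule preserves_positivity_hankel_if_all)
  ultimately show "?hankel \<longleftrightarrow> ?am" "?am \<longleftrightarrow> ?all" by blast+
next
  fix \<rho> :: ereal
  show "preserves_positivity F (positive_hankel_matrices (right_open_interval \<rho>)) \<longleftrightarrow>
      absolutely_monotonic \<rho> F"
    "absolutely_monotonic \<rho> F \<longleftrightarrow> preserves_positivity F (positive_matrices (right_open_interval \<rho>))"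
    using absolutely_monotonic_if_preserves_hankel preserves_positivity_open
      preserves_positivity_hankel_if_all by blast+
qed

end
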